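(* Let $f:\mathbf K^m\to\mathbf K^n$ be $\mu^m$-measurable. Then for each $i=1,\dots,m$ the set $A_i:=\mathrm{dom}\,{}_{ap}D_if$ is $\mu^m$-measurable, the set $V_i:=\{(x,t)\in\mathbf K^{m}\times\mathbf K:\ {}_{ap}\bar\Phi^1f(x;e_i;t)\text{ exists}\}$ is $\mu^{m+1}$-measurable with $\mu^{m+1}(\mathbf K^{m+1}\setminus V_i)=0$, and ${}_{ap}D_if$ and $(x,t)\mapsto {}_{ap}\bar\Phi^1f(x;e_i;t)$ are $\mu^m|_{A_i}$- and $\mu^{m+1}|_{V_i}$-measurable functions respectively. Moreover: (1) for $\mu^{m+1}$-almost all points $(x,t)$ of $V:=\bigcap_{i=1}^mV_i$ and each $v=v_1e_1+\dots+v_me_m\in\mathbf K^m$, $${}_{ap}\bar\Phi^1f(x;v;t)=\sum_{i=1}^m v_i\;{}_{ap}\bar\Phi^1f\bigl(x+(e_{i+1}v_{i+1}+\dots+e_mv_m)t;\,e_i;\,v_it\bigr)$$ (a summand with $v_i=0$ being $0$); (2) for $\mu^m$-almost all points $x$ of $A:=\bigcap_{i=1}^mA_i$ and each $v\in\mathbf K^m$, $${}_{ap}Df(x).v=\sum_{i=1}^mv_i\;{}_{ap}D_if(x).$$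
   Context: $\mathbf K$ is an infinite locally compact field with a non-trivial non-archimedean multiplicative norm $|\cdot|$ (normalized as the modular function); $\mathbf K^m$ has the max norm and standard basis $e_1,\dots,e_m$; $B(\mathbf K^m,x,R)$ is the closed ball. $\mu$ is the Haar measure on $\mathbf K$ with $\mu(B(\mathbf K,0,1))=1$, $\mu^m$ its $m$-fold product (completed). A set $E\subset\mathbf K^m$ has density zero at $x$ if $\mu^m(E\cap B(\mathbf K^m,x,R))/\mu^m(B(\mathbf K^m,x,R))\to0$ as $R\to0$. For a function $h$ with values in a topological space, $y=ap\lim_{z\to x}h(z)$ means that for each neighbourhood $W$ of $y$ the complement of $h^{-1}(W)$ has density zero at $x$. ${}_{ap}D_if(x):=ap\lim_{t\to0}[f(x+te_i)-f(x)]/t$ (with respect to $\mu$ on $\mathbf K$). ${}_{ap}\bar\Phi^1f(x;v;t):=[f(x+vt)-f(x)]/t$ for $t\neq0$, and ${}_{ap}\bar\Phi^1f(x;v;0):=ap\lim_{t\to0}[f(x+vt)-f(x)]/t$ when it exists. ${}_{ap}Df(x)$ is the $\mathbf K$-linear map $T:\mathbf K^m\to\mathbf K^n$ with $ap\lim_{z\to x}|f(z)-f(x)-T(z-x)|/|z-x|=0$ (with respect to $\mu^m$); assertion (2) includes its existence. *)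

theory Defs
  imports "HOL-Analysis.Analysis"
begin

(* The field K, with its norm absv; the topology is the one induced by absv, and absv x = 0
   iff x = 0 follows from absv_dist.  The library's norm is not usable here, since it is
   constrained to real normed spaces.  A field with a non-trivial norm is infinite. *)
class nonarch_local_field = field + metric_space +
  fixes absv :: "'a \<Rightarrow> real"
  assumes absv_dist: "dist x y = absv (x - y)"
    and absv_mult: "absv (x * y) = absv x * absv y"
    and absv_ultrametric: "absv (x + y) \<le> max (absv x) (absv y)"
    and absv_nontrivial: "\<exists>x. x \<noteq> 0 \<and> absv x \<noteq> 1"
    and locally_compact: "\<exists>U C. open U \<and> compact C \<and> x \<in> U \<and> U \<subseteq> C"

(* K is second countable, so regularity of a locally finite Borel measure is automatic. *)
definition haar_measure :: "'k::nonarch_local_field measure \<Rightarrow> bool" where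
  "haar_measure \<mu> \<longleftrightarrow>
     sets \<mu> = sets borel \<and>
     (\<forall>a. \<forall>E\<in>sets borel. emeasure \<mu> ((\<lambda>x. a + x) ` E) = emeasure \<mu> E) \<and>
     (\<forall>C. compact C \<longrightarrow> emeasure \<mu> C < \<infinity>) \<and>
     (\<forall>U. open U \<and> U \<noteq> {} \<longrightarrow> emeasure \<mu> U > 0)"

definition absv_is_modulus :: "'k::nonarch_local_field measure \<Rightarrow> bool" where
  "absv_is_modulus \<mu> \<longleftrightarrow>
     (\<forall>a. a \<noteq> 0 \<longrightarrow> (\<forall>E\<in>sets borel.
        emeasure \<mu> ((\<lambda>x. a * x) ` E) = ennreal (absv a) * emeasure \<mu> E))"

(* The library's metric on vectors is Euclidean; only its topology, the product topology, is
   used here. *)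
definition max_norm :: "'k::nonarch_local_field ^ 'm \<Rightarrow> real" where
  "max_norm x = Max (range (\<lambda>i. absv (x $ i)))"

(* K is second countable, hence the product sigma-algebra is the Borel one and the map below
   is measurable. *)
definition borel_power :: "'k::nonarch_local_field measure \<Rightarrow> ('k ^ 'm) measure" where
  "borel_power \<mu> = distr (\<Pi>\<^sub>M i\<in>(UNIV :: 'm set). \<mu>) borel (\<lambda>x. \<chi> i. x i)"

(* mu^m *)
definition haar_power :: "'k::nonarch_local_field measure \<Rightarrow> ('k ^ 'm) measure" where
  "haar_power \<mu> = completion (borel_power \<mu>)"

(* mu^{m+1}, with K^{m+1} written as K^m x K *)
definition haar_power_Suc :: "'k::nonarch_local_field measure \<Rightarrow> (('k ^ 'm) \<times> 'k) measure" where
  "haar_power_Suc \<mu> = completion (borel_power \<mu> \<Otimes>\<^sub>M \<mu>)"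

(* Densities and approximate limits are taken for a measure M and a norm N, to serve both
   (mu, absv) on K and (mu^m, max_norm) on K^m.  The set E may be non-measurable, where
   emeasure would silently return 0; the outer measure is used instead. *)
definition norm_cball :: "('a::ab_group_add \<Rightarrow> real) \<Rightarrow> 'a \<Rightarrow> real \<Rightarrow> 'a set" where
  "norm_cball N x R = {z. N (z - x) \<le> R}"

definition density_zero ::
    "'a::ab_group_add measure \<Rightarrow> ('a \<Rightarrow> real) \<Rightarrow> 'a set \<Rightarrow> 'a \<Rightarrow> bool" where
  "density_zero M N E x \<longleftrightarrow>
     ((\<lambda>R. outer_measure_of M (E \<inter> norm_cball N x R) / emeasure M (norm_cball N x R))
        \<longlongrightarrow> 0) (at_right 0)"

definition has_ap_lim ::
    "'a::ab_group_add measure \<Rightarrow> ('a \<Rightarrow> real) \<Rightarrow> ('a \<Rightarrow> 'b::topological_space) \<Rightarrow> 'a \<Rightarrow> 'b \<Rightarrow> bool"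
  where
  "has_ap_lim M N h x y \<longleftrightarrow> (\<forall>W. open W \<and> y \<in> W \<longrightarrow> density_zero M N (- (h -` W)) x)"

definition diff_quot ::
    "('k::nonarch_local_field ^ 'm \<Rightarrow> 'k ^ 'n) \<Rightarrow> 'k ^ 'm \<Rightarrow> 'k ^ 'm \<Rightarrow> 'k \<Rightarrow> 'k ^ 'n" where
  "diff_quot f x v t = (1 / t) *s (f (x + t *s v) - f x)"

(* The has_-relations are the graphs of the partial functions of the paper; their domains are
   expressed with an existential quantifier, and their values with THE.  In approximate limits
   the value of the function at the limit point itself is irrelevant, singletons being null. *)
definition has_ap_partial :: "'k measure \<Rightarrow> 'm \<Rightarrow> ('k::nonarch_local_field ^ 'm \<Rightarrow> 'k ^ 'n)
    \<Rightarrow> 'k ^ 'm \<Rightarrow> 'k ^ 'n \<Rightarrow> bool" where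
  "has_ap_partial \<mu> i f x y \<longleftrightarrow> has_ap_lim \<mu> absv (\<lambda>t. diff_quot f x (axis i 1) t) 0 y"

definition ap_partial :: "'k measure \<Rightarrow> 'm \<Rightarrow> ('k::nonarch_local_field ^ 'm \<Rightarrow> 'k ^ 'n)
    \<Rightarrow> 'k ^ 'm \<Rightarrow> 'k ^ 'n" where
  "ap_partial \<mu> i f x = (THE y. has_ap_partial \<mu> i f x y)"

definition dom_ap_partial :: "'k measure \<Rightarrow> 'm \<Rightarrow> ('k::nonarch_local_field ^ 'm \<Rightarrow> 'k ^ 'n)
    \<Rightarrow> ('k ^ 'm) set" where
  "dom_ap_partial \<mu> i f = {x. \<exists>y. has_ap_partial \<mu> i f x y}"

definition has_ap_Phi :: "'k measure \<Rightarrow> ('k::nonarch_local_field ^ 'm \<Rightarrow> 'k ^ 'n)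
    \<Rightarrow> 'k ^ 'm \<Rightarrow> 'k ^ 'm \<Rightarrow> 'k \<Rightarrow> 'k ^ 'n \<Rightarrow> bool" where
  "has_ap_Phi \<mu> f x v t y \<longleftrightarrow>
     (if t = 0 then has_ap_lim \<mu> absv (\<lambda>s. diff_quot f x v s) 0 y
      else y = diff_quot f x v t)"

definition ap_Phi :: "'k measure \<Rightarrow> ('k::nonarch_local_field ^ 'm \<Rightarrow> 'k ^ 'n)
    \<Rightarrow> 'k ^ 'm \<Rightarrow> 'k ^ 'm \<Rightarrow> 'k \<Rightarrow> 'k ^ 'n" where
  "ap_Phi \<mu> f x v t = (THE y. has_ap_Phi \<mu> f x v t y)"

definition ap_Phi_exists :: "'k measure \<Rightarrow> ('k::nonarch_local_field ^ 'm \<Rightarrow> 'k ^ 'n)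
    \<Rightarrow> 'k ^ 'm \<Rightarrow> 'k ^ 'm \<Rightarrow> 'k \<Rightarrow> bool" where
  "ap_Phi_exists \<mu> f x v t \<longleftrightarrow> (\<exists>y. has_ap_Phi \<mu> f x v t y)"

definition has_ap_derivative :: "'k measure \<Rightarrow> ('k::nonarch_local_field ^ 'm \<Rightarrow> 'k ^ 'n)
    \<Rightarrow> 'k ^ 'm \<Rightarrow> ('k ^ 'm \<Rightarrow> 'k ^ 'n) \<Rightarrow> bool" where
  "has_ap_derivative \<mu> f x T \<longleftrightarrow>
     Vector_Spaces.linear (*s) (*s) T \<and>
     has_ap_lim (haar_power \<mu>) max_norm
       (\<lambda>z. max_norm (f z - f x - T (z - x)) / max_norm (z - x)) x 0"

definition ap_differentiable :: "'k measure \<Rightarrow> ('k::nonarch_local_field ^ 'm \<Rightarrow> 'k ^ 'n)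
    \<Rightarrow> 'k ^ 'm \<Rightarrow> bool" where
  "ap_differentiable \<mu> f x \<longleftrightarrow> (\<exists>T. has_ap_derivative \<mu> f x T)"

definition ap_derivative :: "'k measure \<Rightarrow> ('k::nonarch_local_field ^ 'm \<Rightarrow> 'k ^ 'n)
    \<Rightarrow> 'k ^ 'm \<Rightarrow> 'k ^ 'm \<Rightarrow> 'k ^ 'n" where
  "ap_derivative \<mu> f x = (THE T. has_ap_derivative \<mu> f x T)"

definition dom_ap_Phi :: "'k measure \<Rightarrow> 'm \<Rightarrow> ('k::nonarch_local_field ^ 'm \<Rightarrow> 'k ^ 'n)
    \<Rightarrow> (('k ^ 'm) \<times> 'k) set" where
  "dom_ap_Phi \<mu> i f = {(x, t). ap_Phi_exists \<mu> f x (axis i 1) t}"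

end

theory Submission
  imports Defs
begin

text \<open>For a Borel function the approximate partial derivative at \<open>x\<close> exists if and only if, at every
  scale \<open>\<rho> ^ k\<close>, some \<open>d\<close> from a fixed countable dense set satisfies: the set of those \<open>t\<close> where
  \<open>f (x + t *s axis i 1) - f x - t *s d\<close> exceeds \<open>\<rho> ^ k * absv t\<close> has density zero at \<open>0\<close>. This is a
  countable combination of Borel conditions on \<open>x\<close>.

  For the differentiability one passes from \<open>x\<close> to \<open>x + v\<close> by changing one coordinate after the other.
  The intermediate points lie in the null sets \<open>x + span {axis i 1 | i \<in> I}\<close>, so what is needed is a
  density theorem along such slices: for a Borel set \<open>C\<close>, almost every \<open>x \<in> C\<close> is a density point of
  the slice of \<open>C\<close> through \<open>x\<close>. It follows from a maximal inequality, which is proved by sorting the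
  points by the first ball on which the proportion is large; by the ultrametric inequality these
  sets are invariant under translation by the ball, so no covering argument is needed. Applied to
  the countably many sets where the density condition for \<open>d\<close> holds with a given modulus, it shows
  that at almost every \<open>x\<close> the increments in direction \<open>i\<close> are controlled by the same \<open>d\<close> at most
  points of the slice through \<open>x\<close>; continuity properties of the partial derivatives are not needed.\<close>

subsection \<open>Non-archimedean local fields\<close>

text \<open>The modulus in the density condition has to be fixed because the radius below which the
  condition takes effect varies from point to point; once it is fixed, the condition at an
  intermediate point is available on the very ball in which the increment lies. Densities are read
  off on balls of radius \<open>\<rho> ^ j\<close>, where \<rho> is the value of some
  \<open>p\<close> with 0 < \<open>absv p\<close> < 1: the measures of consecutive balls differ by a
  constant factor, so nothing is lost, and every density condition becomes countable. Errors are
  first compared with the radius of the ball and only at the end with the norm of the increment, by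
  cutting the ball into shells. Since errors combine by maximum rather than by sum, the tolerance
  does not grow with the number of coordinates. The assertions about \<open>ap_Phi\<close> are
  elementary by comparison: almost every pair has t \<noteq> 0, where the quotient always exists and
  the sum telescopes.\<close>

lemma absv_eq_0_iff [simp]: "absv (x::'k::nonarch_local_field) = 0 \<longleftrightarrow> x = 0"
  using absv_dist[of x 0] dist_eq_0_iff[of x 0] by simp

lemma absv_0 [simp]: "absv (0::'k::nonarch_local_field) = 0"
  by simp

lemma absv_nonneg [simp]: "0 \<le> absv (x::'k::nonarch_local_field)"
  using zero_le_dist[of x 0] by (simp add: absv_dist)

lemma absv_not_neg [simp]: "\<not> absv (x::'k::nonarch_local_field) < 0"
  by (simp add: not_less)

lemma absv_pos_iff [simp]: "0 < absv (x::'k::nonarch_local_field) \<longleftrightarrow> x \<noteq> 0"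
  using absv_nonneg[of x] absv_eq_0_iff[of x] by linarith

lemma absv_1 [simp]: "absv (1::'k::nonarch_local_field) = 1"
  using absv_mult[of "1::'k" 1] absv_eq_0_iff[of "1::'k"] by (auto simp del: absv_eq_0_iff)

lemma absv_minus [simp]: "absv (- x) = absv (x::'k::nonarch_local_field)"
  using dist_commute[of 0 x] by (simp add: absv_dist)

lemma absv_minus_commute: "absv (x - y) = absv (y - (x::'k::nonarch_local_field))"
  using absv_minus[of "x - y"] by simp

lemma absv_inverse: "absv (inverse x) = inverse (absv (x::'k::nonarch_local_field))"
proof (cases "x = 0")
  case False
  then have "absv x * absv (inverse x) = 1"
    by (simp flip: absv_mult)
  then show ?thesis
    by (metis inverse_unique)
qed auto

lemma absv_power: "absv (x ^ n) = absv (x::'k::nonarch_local_field) ^ n"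
  by (induction n) (auto simp: absv_mult)

lemma absv_divide: "absv (x / y) = absv x / absv (y::'k::nonarch_local_field)"
  by (simp add: divide_inverse absv_mult absv_inverse)

lemma absv_add_le: "absv x \<le> r \<Longrightarrow> absv y \<le> r \<Longrightarrow> absv (x + y) \<le> (r::real)"
  for x y :: "'k::nonarch_local_field"
  using absv_ultrametric[of x y] by linarith

lemma absv_diff_le: "absv x \<le> r \<Longrightarrow> absv y \<le> r \<Longrightarrow> absv (x - y) \<le> (r::real)"
  for x y :: "'k::nonarch_local_field"
  using absv_add_le[of x r "- y"] by simp

text \<open>This fixes the scale of the whole development. Any such \<open>p\<close> will do, a
  uniformizer or not, since only the scaling of balls by its powers enters.\<close>

lemma exists_absv_less_1: "\<exists>p::'k::nonarch_local_field. p \<noteq> 0 \<and> absv p < 1"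
proof -
  obtain x :: 'k where x: "x \<noteq> 0" "absv x \<noteq> 1"
    using absv_nontrivial by blast
  show ?thesis
  proof (cases "absv x < 1")
    case False
    with x have "absv (inverse x) < 1"
      by (simp add: absv_inverse inverse_less_1_iff)
    with x show ?thesis
      by (metis inverse_nonzero_iff_nonzero)
  qed (use x in blast)
qed

section \<open>Topology of the field and of its finite powers\<close>

lemma tendsto_field_mult:
  fixes f g :: "'a \<Rightarrow> 'k::nonarch_local_field"
  assumes f: "(f \<longlongrightarrow> a) F" and g: "(g \<longlongrightarrow> b) F"
  shows "((\<lambda>x. f x * g x) \<longlongrightarrow> a * b) F"
proof (rule tendstoI)
  fix e :: real assume e: "0 < e"
  \<comment> \<open>\<open>K\<close> dominates \<open>absv a\<close>, \<open>absv b\<close> and, as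
    d \<le> 1, also \<open>absv (g x)\<close> near the limit. With \<open>d * K \<le> e\<close> both
    halves of the split product are below \<open>e\<close>, and the ultrametric inequality asks for
    no more.\<close>
  define K where "K = 1 + absv a + absv b"
  have K: "K > 0" "absv a < K" "absv b < K"
    using absv_nonneg[of a] absv_nonneg[of b] unfolding K_def by linarith+
  define d where "d = min 1 (e / K)"
  have d: "d > 0" "d \<le> 1" "d * K \<le> e"
    using e K by (auto simp: d_def min_def field_simps)
  have "\<forall>\<^sub>F x in F. dist (f x) a < d" "\<forall>\<^sub>F x in F. dist (g x) b < d"
    using f g d(1) by (auto intro: tendstoD)
  then show "\<forall>\<^sub>F x in F. dist (f x * g x) (a * b) < e"
  proof eventually_elim
    case (elim x)
    have eq: "f x * g x - a * b = (f x - a) * g x + a * (g x - b)"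
      by (simp add: algebra_simps)
    have "absv (g x) \<le> max (absv (g x - b)) (absv b)"
      using absv_ultrametric[of "g x - b" b] by simp
    also have "\<dots> < K"
      using elim d K absv_nonneg[of a] absv_nonneg[of b] unfolding absv_dist K_def by linarith
    finally have gK: "absv (g x) < K" .
    have "absv (f x - a) * absv (g x) < d * K"
      using elim gK K d by (intro mult_strict_mono) (auto simp: absv_dist)
    moreover have "absv a * absv (g x - b) < K * d"
      using elim K d by (intro mult_strict_mono) (auto simp: absv_dist)
    ultimately have "max (absv ((f x - a) * g x)) (absv (a * (g x - b))) < e"
      using d by (auto simp: absv_mult mult.commute)
    then show ?case
      using absv_ultrametric[of "(f x - a) * g x" "a * (g x - b)"] unfolding absv_dist eq by linarith
  qed
qed

lemma tendsto_field_add: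
  fixes f g :: "'a \<Rightarrow> 'k::nonarch_local_field"
  assumes f: "(f \<longlongrightarrow> a) F" and g: "(g \<longlongrightarrow> b) F"
  shows "((\<lambda>x. f x + g x) \<longlongrightarrow> a + b) F"
proof (rule tendstoI)
  fix e :: real assume e: "0 < e"
  have "\<forall>\<^sub>F x in F. dist (f x) a < e" "\<forall>\<^sub>F x in F. dist (g x) b < e"
    using f g e by (auto intro: tendstoD)
  then show "\<forall>\<^sub>F x in F. dist (f x + g x) (a + b) < e"
  proof eventually_elim
    case (elim x)
    then show ?case
      using absv_ultrametric[of "f x - a" "g x - b"] by (simp add: absv_dist add_diff_add)
  qed
qed

lemma tendsto_field_minus:
  fixes f :: "'a \<Rightarrow> 'k::nonarch_local_field"
  assumes f: "(f \<longlongrightarrow> a) F"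
  shows "((\<lambda>x. - f x) \<longlongrightarrow> - a) F"
  using tendsto_field_mult[OF tendsto_const[of "-1"] f] by simp

instance nonarch_local_field \<subseteq> topological_semigroup_mult
proof
  fix a b :: 'a
  show "((\<lambda>x. fst x * snd x) \<longlongrightarrow> a * b) (nhds a \<times>\<^sub>F nhds b)"
    by (intro tendsto_field_mult filterlim_fst filterlim_snd)
qed

instance nonarch_local_field \<subseteq> topological_ab_group_add
proof
  fix a b :: 'a
  show "((\<lambda>x. fst x + snd x) \<longlongrightarrow> a + b) (nhds a \<times>\<^sub>F nhds b)"
    by (intro tendsto_field_add filterlim_fst filterlim_snd)
  show "(uminus \<longlongrightarrow> - a) (nhds a)"
    using tendsto_field_minus[OF filterlim_ident[of "nhds a"]] by simp
qed

lemma closed_subset_compact: "compact T \<Longrightarrow> S \<subseteq> T \<Longrightarrow> closed S \<Longrightarrow> compact S"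
  for S T :: "'a::t2_space set"
  using compact_Int_closed[of T S] by (simp add: inf.absorb2)

text \<open>Local compactness yields one compact ball around 0. Multiplying by a large power of
  \<open>inverse p\<close> blows it up continuously until it covers the given ball.\<close>

lemma compact_cball_field: "compact (cball (a::'k::nonarch_local_field) r)"
proof -
  obtain U C where UC: "open U" "compact C" "(0::'k) \<in> U" "U \<subseteq> C"
    using locally_compact by blast
  obtain e where e: "e > 0" "cball 0 e \<subseteq> U"
    using UC(1,3) open_contains_cball by blast
  obtain p :: 'k where p: "p \<noteq> 0" "absv p < 1"
    using exists_absv_less_1 by blast
  have "compact (cball (0::'k) e)"
    using UC(2,4) e(2) closed_subset_compact by (meson closed_cball order_trans)
  obtain n where n: "absv p ^ n * r < e"
  proof -
    have "(\<lambda>n. absv p ^ n * r) \<longlonglongrightarrow> 0 * r"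
      using p by (intro tendsto_mult tendsto_const LIMSEQ_realpow_zero) auto
    then have "\<forall>\<^sub>F n in sequentially. absv p ^ n * r < e"
      using e(1) by (intro order_tendstoD) auto
    then show ?thesis
      using that by (auto simp: eventually_sequentially)
  qed
  have "compact ((\<lambda>x. a + inverse (p ^ n) * x) ` cball 0 e)"
    using \<open>compact (cball 0 e)\<close> by (intro compact_continuous_image continuous_intros)
  moreover have "cball a r \<subseteq> (\<lambda>x. a + inverse (p ^ n) * x) ` cball 0 e"
  proof
    fix y assume y: "y \<in> cball a r"
    have "absv (p ^ n * (y - a)) \<le> absv p ^ n * r"
      using y by (auto simp: absv_mult absv_power absv_dist absv_minus_commute[of y] intro!: mult_left_mono)
    then show "y \<in> (\<lambda>x. a + inverse (p ^ n) * x) ` cball 0 e"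
      using n p by (intro image_eqI[of _ _ "p ^ n * (y - a)"]) (auto simp: absv_dist mult.assoc[symmetric])
  qed
  ultimately show ?thesis
    by (rule closed_subset_compact) simp
qed

text \<open>Besides compactness this brings completeness, which is used for limits of Cauchy
  sequences and for inner regularity.\<close>

instance nonarch_local_field \<subseteq> heine_borel
proof
  fix f :: "nat \<Rightarrow> 'a" assume "bounded (range f)"
  then obtain a r where "range f \<subseteq> cball a r"
    unfolding bounded_def by (auto simp: subset_iff)
  moreover have "seq_compact (cball a r)"
    by (rule compact_imp_seq_compact[OF compact_cball_field])
  ultimately show "\<exists>l r. strict_mono r \<and> (f \<circ> r) \<longlonglongrightarrow> l"
    unfolding seq_compact_def by (metis rangeI subset_iff)
qed

text \<open>Each compact ball of radius \<open>n\<close> about one fixed centre, for which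
  \<open>undefined\<close> serves, is covered by finitely many balls of radius
  \<open>1 / Suc m\<close>. Over all \<open>m\<close> and \<open>n\<close> these small balls form a
  countable basis.\<close>

lemma heine_borel_countable_basis:
  "\<exists>B::'a::heine_borel set set. countable B \<and> open = generate_topology B"
proof -
  have "\<exists>D. finite D \<and> cball a (real n) \<subseteq> (\<Union>x\<in>D. ball x (1 / Suc m))" for a :: 'a and m n
  proof -
    have "compact (cball a (real n))"
      by (simp add: compact_eq_bounded_closed)
    then show ?thesis
      by (rule compactE_image[of _ "cball a (real n)" "\<lambda>x. ball x (1 / Suc m)"])
        (auto intro!: exI simp del: of_nat_Suc)
  qed
  then have ex: "\<exists>D. finite D \<and> cball undefined (real n) \<subseteq> (\<Union>x\<in>D. ball (x::'a) (1 / Suc m))" for m n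
    by blast
  define D where "D m n = (SOME D. finite D \<and> cball undefined (real n) \<subseteq> (\<Union>x\<in>D. ball (x::'a) (1 / Suc m)))" for m n
  have D: "finite (D m n)" "cball undefined (real n) \<subseteq> (\<Union>x\<in>D m n. ball x (1 / Suc m))" for m n
    using someI_ex[OF ex[of n m]] unfolding D_def by auto
  define B where "B = (\<Union>n m. (\<lambda>x. ball x (1 / Suc m)) ` D m n)"
  have "topological_basis B"
  proof (rule topological_basisI)
    fix S and x :: 'a assume S: "open S" "x \<in> S"
    then obtain e where e: "e > 0" "ball x e \<subseteq> S"
      using open_contains_ball by blast
    obtain m where m: "1 / Suc m < e / 2"
      using e(1) nat_approx_posE[of "e / 2"] by auto
    obtain n where "dist undefined x \<le> real n"
      using real_arch_simple by blast
    then obtain d where d: "d \<in> D m n" "x \<in> ball d (1 / Suc m)"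
      using D(2)[where n=n and m=m] by (force simp del: of_nat_Suc)
    have "ball d (1 / Suc m) \<subseteq> ball x e"
    proof
      fix y assume "y \<in> ball d (1 / Suc m)"
      then show "y \<in> ball x e"
        using d(2) m dist_triangle[of x y d] by (simp add: dist_commute)
    qed
    then show "\<exists>B'\<in>B. x \<in> B' \<and> B' \<subseteq> S"
      using d e(2) unfolding B_def by blast
  qed (auto simp: B_def)
  moreover have "countable B"
    unfolding B_def using D(1) by (intro countable_UN countable_image) (auto intro: countable_finite)
  ultimately show ?thesis
    using topological_basis_imp_subbasis by blast
qed

instance nonarch_local_field \<subseteq> second_countable_topology
  by standard (rule heine_borel_countable_basis)

text \<open>\<open>vec_lambda\<close> is a homeomorphism from the function space with the product
  topology, so a countable basis there is carried over by taking images.\<close>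

instance vec :: ("{metric_space, second_countable_topology}", finite) second_countable_topology
proof
  obtain B :: "('b \<Rightarrow> 'a) set set" where B: "countable B" "topological_basis B"
    using ex_countable_basis by blast
  have cont: "continuous_on UNIV (vec_lambda :: ('b \<Rightarrow> 'a) \<Rightarrow> ('a, 'b) vec)"
    "continuous_on UNIV (vec_nth :: ('a, 'b) vec \<Rightarrow> 'b \<Rightarrow> 'a)"
    by (auto intro!: continuous_on_vec_lambda continuous_on_coordinatewise_then_product
        continuous_on_product_coordinates continuous_intros)
  have "topological_basis ((`) vec_lambda ` B :: ('a, 'b) vec set set)"
  proof (rule topological_basisI)
    fix U :: "('a, 'b) vec set" assume "U \<in> (`) vec_lambda ` B"
    then obtain V where V: "V \<in> B" "U = vec_lambda ` V"
      by blast
    have "U = vec_nth -` V"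
      unfolding V(2) by (auto simp: image_iff) (metis vec_nth_inverse)
    then show "open U"
      using topological_basis_open[OF B(2) V(1)] cont(2) by (simp add: open_vimage)
  next
    fix S and x :: "('a, 'b) vec" assume S: "open S" "x \<in> S"
    have "open (vec_lambda -` S :: ('b \<Rightarrow> 'a) set)"
      using S(1) cont(1) by (intro open_vimage)
    moreover have "vec_nth x \<in> vec_lambda -` S"
      using S(2) by simp
    ultimately obtain V where V: "V \<in> B" "vec_nth x \<in> V" "V \<subseteq> vec_lambda -` S"
      using topological_basisE[OF B(2)] by blast
    then show "\<exists>U\<in>(`) vec_lambda ` B. x \<in> U \<and> U \<subseteq> S"
      by (intro bexI[of _ "vec_lambda ` V"]) (auto simp: image_iff, metis vec_nth_inverse)
  qed
  then show "\<exists>B::('a, 'b) vec set set. countable B \<and> open = generate_topology B"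
    using B(1) topological_basis_imp_subbasis by blast
qed

instance vec :: (topological_monoid_add, finite) topological_monoid_add
proof
  fix a b :: "('a, 'b) vec"
  show "((\<lambda>x. fst x + snd x) \<longlongrightarrow> a + b) (nhds a \<times>\<^sub>F nhds b)"
    by (rule vec_tendstoI) (auto intro!: tendsto_add tendsto_vec_nth filterlim_fst filterlim_snd)
qed

instance vec :: (topological_ab_group_add, finite) topological_ab_group_add
proof
  fix a :: "('a, 'b) vec"
  show "(uminus \<longlongrightarrow> - a) (nhds a)"
    by (rule vec_tendstoI) (auto intro!: tendsto_minus tendsto_vec_nth filterlim_ident)
qed

lemma tendsto_vector_scalar_mult:
  fixes c :: "'a \<Rightarrow> 'k::{times,topological_semigroup_mult}" and g :: "'a \<Rightarrow> 'k ^ 'n"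
  assumes "(c \<longlongrightarrow> a) F" "(g \<longlongrightarrow> b) F"
  shows "((\<lambda>x. c x *s g x) \<longlongrightarrow> a *s b) F"
  by (rule vec_tendstoI) (auto intro!: tendsto_mult tendsto_vec_nth assms)

lemma continuous_on_vector_scalar_mult [continuous_intros]:
  fixes c :: "'a::topological_space \<Rightarrow> 'k::{times,topological_semigroup_mult}" and g :: "'a \<Rightarrow> 'k ^ 'n"
  assumes "continuous_on S c" "continuous_on S g"
  shows "continuous_on S (\<lambda>x. c x *s g x)"
  using assms unfolding continuous_on_def by (blast intro: tendsto_vector_scalar_mult)

subsection \<open>The maximum norm\<close>

lemma max_norm_le_iff: "max_norm (v::'k::nonarch_local_field ^ 'm) \<le> r \<longleftrightarrow> (\<forall>i. absv (v $ i) \<le> r)"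
  unfolding max_norm_def by (subst Max_le_iff) auto

lemma absv_nth_le_max_norm: "absv (v $ i) \<le> max_norm (v::'k::nonarch_local_field ^ 'm)"
  using max_norm_le_iff[of v "max_norm v"] by blast

lemma max_norm_nonneg [simp]: "0 \<le> max_norm (v::'k::nonarch_local_field ^ 'm)"
  using absv_nth_le_max_norm[of v undefined] absv_nonneg order_trans by blast

lemma max_norm_eq_0_iff [simp]: "max_norm (v::'k::nonarch_local_field ^ 'm) = 0 \<longleftrightarrow> v = 0"
proof
  assume "max_norm v = 0"
  then have "absv (v $ i) \<le> 0" for i
    using absv_nth_le_max_norm[of v i] by simp
  then have "absv (v $ i) = 0" for i
    using absv_nonneg order_antisym by blast
  then show "v = 0"
    by (simp add: vec_eq_iff)
next
  assume "v = 0"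
  then have "max_norm v \<le> 0"
    by (simp add: max_norm_le_iff)
  then show "max_norm v = 0"
    using max_norm_nonneg[of v] by linarith
qed

lemma max_norm_0 [simp]: "max_norm (0::'k::nonarch_local_field ^ 'm) = 0"
  by simp

lemma max_norm_minus [simp]: "max_norm (- v) = max_norm (v::'k::nonarch_local_field ^ 'm)"
  by (simp add: max_norm_def)

lemma max_norm_minus_commute: "max_norm (v - w) = max_norm (w - (v::'k::nonarch_local_field ^ 'm))"
  using max_norm_minus[of "v - w"] by simp

lemma max_norm_add_le: "max_norm v \<le> r \<Longrightarrow> max_norm w \<le> r \<Longrightarrow> max_norm (v + w) \<le> r"
  for v w :: "'k::nonarch_local_field ^ 'm"
  by (simp add: max_norm_le_iff absv_add_le)

lemma max_norm_diff_le: "max_norm v \<le> r \<Longrightarrow> max_norm w \<le> r \<Longrightarrow> max_norm (v - w) \<le> r"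
  for v w :: "'k::nonarch_local_field ^ 'm"
  by (simp add: max_norm_le_iff absv_diff_le)

lemma max_norm_attained: "\<exists>i. max_norm (v::'k::nonarch_local_field ^ 'm) = absv (v $ i)"
  using Max_in[of "range (\<lambda>i. absv (v $ i))"] unfolding max_norm_def by (simp add: image_iff)

lemma max_norm_scale: "max_norm (c *s v) = absv c * max_norm (v::'k::nonarch_local_field ^ 'm)"
proof (rule antisym)
  show "max_norm (c *s v) \<le> absv c * max_norm v"
    by (simp add: max_norm_le_iff absv_mult mult_left_mono absv_nth_le_max_norm)
  obtain i where "max_norm v = absv (v $ i)"
    using max_norm_attained by blast
  then show "absv c * max_norm v \<le> max_norm (c *s v)"
    using absv_nth_le_max_norm[of "c *s v" i] by (simp add: absv_mult)
qed

lemma max_norm_axis [simp]: "max_norm (axis i 1 :: 'k::nonarch_local_field ^ 'm) = 1"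
proof (rule antisym)
  show "max_norm (axis i 1 :: 'k ^ 'm) \<le> 1"
    by (simp add: max_norm_le_iff axis_def)
  show "1 \<le> max_norm (axis i 1 :: 'k ^ 'm)"
    using absv_nth_le_max_norm[of "axis i 1 :: 'k ^ 'm" i] by simp
qed

lemma continuous_on_absv [continuous_intros]:
  fixes f :: "'a::topological_space \<Rightarrow> 'k::nonarch_local_field"
  assumes "continuous_on S f"
  shows "continuous_on S (\<lambda>x. absv (f x))"
proof -
  have "continuous_on S (\<lambda>x. dist (f x) 0)"
    by (intro continuous_intros assms)
  then show ?thesis
    by (simp add: absv_dist)
qed

lemma closed_max_norm_cball: "closed {w::'k::nonarch_local_field ^ 'm. max_norm (w - y) \<le> r}"
  unfolding max_norm_le_iff vector_minus_component
  by (intro closed_Collect_all closed_Collect_le continuous_intros)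

text \<open>In each coordinate an ultrametric ball contains the ball of the same radius about any of
  its points. Hence the balls \<le> r are themselves neighbourhoods and can be inserted into the
  definition of an approximate limit.\<close>

lemma open_max_norm_cball:
  assumes "r > 0"
  shows "open {w::'k::nonarch_local_field ^ 'm. max_norm (w - y) \<le> r}"
proof -
  have op: "open {w::'k. absv (w - a) \<le> r}" for a
    unfolding open_contains_ball
  proof
    fix w assume w: "w \<in> {w::'k. absv (w - a) \<le> r}"
    have "ball w r \<subseteq> {w. absv (w - a) \<le> r}"
    proof
      fix z assume "z \<in> ball w r"
      then have "absv (z - w) \<le> r"
        by (simp add: absv_dist absv_minus_commute)
      then show "z \<in> {w. absv (w - a) \<le> r}"
        using w absv_add_le[of "z - w" r "w - a"] by simp
    qed
    then show "\<exists>e>0. ball w e \<subseteq> {w. absv (w - a) \<le> r}"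
      using assms by blast
  qed
  have "{w::'k ^ 'm. max_norm (w - y) \<le> r} = (\<Inter>i. (\<lambda>w. w $ i) -` {w. absv (w - y $ i) \<le> r})"
    by (auto simp: max_norm_le_iff)
  also have "open \<dots>"
    by (rule open_INT) (intro finite ballI open_vimage op continuous_on_component continuous_on_id)+
  finally show ?thesis .
qed

lemma open_contains_max_norm_cball:
  assumes "open W" "y \<in> W"
  shows "\<exists>e>0. {w::'k::nonarch_local_field ^ 'm. max_norm (w - y) \<le> e} \<subseteq> W"
proof -
  obtain e where e: "e > 0" "ball y e \<subseteq> W"
    using assms open_contains_ball by blast
  \<comment> \<open>The metric on vectors is Euclidean and at most the sum of the coordinate
    distances. The radius \<open>e / (2 * c)\<close> keeps this sum at \<open>e / 2\<close>,
    strictly below \<open>e\<close>.\<close>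
  define c where "c = real CARD('m)"
  have c: "c > 0"
    by (simp add: c_def)
  have "{w. max_norm (w - y) \<le> e / (2 * c)} \<subseteq> ball y e"
  proof safe
    fix w assume w: "max_norm (w - y) \<le> e / (2 * c)"
    have "dist w y \<le> (\<Sum>i\<in>UNIV. dist (w $ i) (y $ i))"
      unfolding dist_vec_def by (rule L2_set_le_sum) simp
    also have "\<dots> \<le> (\<Sum>i\<in>(UNIV::'m set). e / (2 * c))"
      using w by (intro sum_mono) (simp add: absv_dist max_norm_le_iff)
    also have "\<dots> = e / 2"
      using c by (simp add: c_def)
    finally show "w \<in> ball y e"
      using e(1) by (simp add: dist_commute)
  qed
  then show ?thesis
    using e c by (intro exI[of _ "e / (2 * c)"]) auto
qed

subsection \<open>Outer measures and null densities\<close>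

text \<open>Every set of the completion lies in a set of \<open>M\<close> with the same measure.
  Densities with respect to \<open>haar_power \<mu>\<close> can therefore be computed with the Borel
  product measure.\<close>

lemma outer_measure_of_completion: "outer_measure_of (completion M) A = outer_measure_of M A"
proof (rule antisym)
  show "outer_measure_of (completion M) A \<le> outer_measure_of M A"
    unfolding outer_measure_of_def by (rule INF_mono) auto
  show "outer_measure_of M A \<le> outer_measure_of (completion M) A"
    unfolding outer_measure_of_def
  proof (rule INF_mono)
    fix E assume "E \<in> {E \<in> sets (completion M). A \<subseteq> E}"
    then show "\<exists>E'\<in>{E \<in> sets M. A \<subseteq> E}. emeasure M E' \<le> emeasure (completion M) E"
      using completion_upper[of E M] by (metis (mono_tags, lifting) mem_Collect_eq order_refl order_trans)
  qed
qed

lemma outer_measure_of_Un_le: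
  assumes "A \<subseteq> space M" "B \<subseteq> space M"
  shows "outer_measure_of M (A \<union> B) \<le> outer_measure_of M A + outer_measure_of M B"
proof -
  obtain A' B' where *: "A' \<in> sets M" "A \<subseteq> A'" "outer_measure_of M A = emeasure M A'"
    "B' \<in> sets M" "B \<subseteq> B'" "outer_measure_of M B = emeasure M B'"
    using outer_measure_of_attain[OF assms(1)] outer_measure_of_attain[OF assms(2)] by blast
  have "outer_measure_of M (A \<union> B) \<le> outer_measure_of M (A' \<union> B')"
    using * by (intro outer_measure_of_mono) auto
  also have "\<dots> \<le> emeasure M A' + emeasure M B'"
    using * by (simp add: emeasure_subadditive)
  finally show ?thesis
    using * by simp
qed

lemma ennreal_divide_le_iff:
  assumes "0 < b" "b < (top::ennreal)"
  shows "a / b \<le> e \<longleftrightarrow> a \<le> e * b"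
  using assms by (metis divide_le_posI_ennreal ennreal_divide_self ennreal_times_divide
      less_irrefl mult.commute mult.right_neutral mult_left_mono zero_le)

lemma ennreal_tendsto_0_iff:
  fixes f :: "'a \<Rightarrow> ennreal"
  shows "(f \<longlongrightarrow> 0) F \<longleftrightarrow> (\<forall>e>0. \<forall>\<^sub>F x in F. f x \<le> ennreal e)"
proof safe
  fix e :: real assume "(f \<longlongrightarrow> 0) F" "0 < e"
  then have "\<forall>\<^sub>F x in F. f x < ennreal e"
    by (intro order_tendstoD) auto
  then show "\<forall>\<^sub>F x in F. f x \<le> ennreal e"
    by eventually_elim auto
next
  assume *: "\<forall>e>0. \<forall>\<^sub>F x in F. f x \<le> ennreal e"
  show "(f \<longlongrightarrow> 0) F"
  proof (rule order_tendstoI)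
    fix a :: ennreal assume "0 < a"
    then obtain b where b: "0 < b" "b < a"
      using dense by blast
    then have "b < top"
      using order_less_le_trans top_greatest by blast
    then have "ennreal (enn2real b) = b" "enn2real b > 0"
      using b by (auto simp: enn2real_positive_iff)
    then have "\<forall>\<^sub>F x in F. f x \<le> b"
      using * by metis
    then show "\<forall>\<^sub>F x in F. f x < a"
      by eventually_elim (use b in auto)
  qed auto
qed

text \<open>A common frame for the field and for its finite powers. The ratio \<open>c\<close> of
  the measures of consecutive balls is kept apart from the ratio \<open>\<rho>\<close> of their
  radii, since it depends on the dimension.\<close>

locale ultrametric_haar = sigma_finite_measure M
  for M :: "'a::{second_countable_topology, complete_space, topological_ab_group_add} measure" +
  fixes N :: "'a \<Rightarrow> real" and \<rho> c :: real
  assumes sets_M: "sets M = sets borel"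
    and translate: "E \<in> sets borel \<Longrightarrow> emeasure M ((\<lambda>x. a + x) -` E) = emeasure M E"
    and N_0: "N 0 = 0"
    and N_add: "N v \<le> r \<Longrightarrow> N w \<le> r \<Longrightarrow> N (v + w) \<le> r"
    and N_minus: "N (- v) = N v"
    and N_ball_borel: "{v. N v \<le> r} \<in> sets borel"
    and N_ball_small: "open U \<Longrightarrow> 0 \<in> U \<Longrightarrow> \<exists>r>0. {v. N v \<le> r} \<subseteq> U"
    and emeasure_ball_finite: "emeasure M {v. N v \<le> r} < \<infinity>"
    and emeasure_ball_pos: "0 < r \<Longrightarrow> 0 < emeasure M {v. N v \<le> r}"
    and rho: "0 < \<rho>" "\<rho> < 1"
    and c: "0 < c" "c < 1"
    and emeasure_ball_scale: "emeasure M {v. N v \<le> \<rho> * r} = ennreal c * emeasure M {v. N v \<le> r}"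
begin

lemma space_M [simp]: "space M = UNIV"
  using sets_eq_imp_space_eq[OF sets_M] by simp

definition B :: "nat \<Rightarrow> 'a set" where "B j = {v. N v \<le> \<rho> ^ j}"

lemma B_borel [measurable]: "B j \<in> sets borel"
  unfolding B_def by (rule N_ball_borel)

lemma B_sets [measurable]: "B j \<in> sets M"
  by (simp add: sets_M B_borel)

lemma measurable_M_iff: "measurable M L = measurable borel L"
  by (rule measurable_cong_sets[OF sets_M refl])

lemma zero_in_B [simp]: "0 \<in> B j"
  using rho by (simp add: B_def N_0)

lemma B_add: "v \<in> B j \<Longrightarrow> w \<in> B j \<Longrightarrow> v + w \<in> B j"
  by (simp add: B_def N_add)

lemma B_minus: "v \<in> B j \<Longrightarrow> - v \<in> B j"
  by (simp add: B_def N_minus)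

text \<open>\<open>B j\<close> is a subgroup, so translation by one of its elements maps it onto
  itself. In this form the ultrametric inequality enters the measure theory below.\<close>

lemma B_add_iff: "v \<in> B j \<Longrightarrow> v + w \<in> B j \<longleftrightarrow> w \<in> B j"
  using B_add[of v j w] B_add[of "- v" j "v + w"] B_minus by auto

lemma B_antimono: "i \<le> j \<Longrightarrow> B j \<subseteq> B i"
  using rho power_decreasing[of i j \<rho>] by (auto simp: B_def intro: order_trans)

lemma emeasure_B_finite: "emeasure M (B j) < \<infinity>"
  unfolding B_def by (rule emeasure_ball_finite)

lemma emeasure_B_pos: "0 < emeasure M (B j)"
  unfolding B_def using rho by (intro emeasure_ball_pos) auto

lemma emeasure_B_add: "emeasure M (B (j + n)) = ennreal (c ^ n) * emeasure M (B j)"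
proof (induction n)
  case (Suc n)
  have "emeasure M (B (j + Suc n)) = ennreal c * emeasure M (B (j + n))"
    using emeasure_ball_scale[of "\<rho> ^ (j + n)"] by (simp add: B_def)
  then show ?case
    using c by (simp add: Suc ennreal_mult mult.assoc)
qed simp

lemma B_tendsto_0:
  assumes "open U" "x \<in> U"
  shows "\<forall>\<^sub>F j in sequentially. \<forall>v\<in>B j. x + v \<in> U"
proof -
  have "open ((\<lambda>v. x + v) -` U)"
    using assms(1) by (intro open_vimage continuous_intros)
  then obtain r where r: "r > 0" "{v. N v \<le> r} \<subseteq> (\<lambda>v. x + v) -` U"
    using N_ball_small[of "(\<lambda>v. x + v) -` U"] assms(2) by auto
  have "(\<lambda>j. \<rho> ^ j) \<longlonglongrightarrow> 0"
    using rho by (intro LIMSEQ_realpow_zero) auto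
  then have "\<forall>\<^sub>F j in sequentially. \<rho> ^ j < r"
    using r(1) by (intro order_tendstoD) auto
  then show ?thesis
  proof eventually_elim
    case (elim j)
    then have "B j \<subseteq> {v. N v \<le> r}"
      by (auto simp: B_def intro: order_trans)
    then show ?case
      using r(2) by blast
  qed
qed

lemma distr_translate: "distr M M (\<lambda>x. a + x) = M"
proof (rule measure_eqI)
  fix E assume "E \<in> sets (distr M M (\<lambda>x. a + x))"
  then have E: "E \<in> sets borel"
    by (simp add: sets_M)
  have "(\<lambda>x. a + x) \<in> M \<rightarrow>\<^sub>M M"
    unfolding measurable_cong_sets[OF sets_M sets_M]
    by (intro borel_measurable_continuous_onI continuous_intros)
  then show "emeasure (distr M M (\<lambda>x. a + x)) E = emeasure M E"
    using E by (simp add: emeasure_distr sets_M translate)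
qed simp

lemma nn_integral_translate:
  assumes "f \<in> borel_measurable borel"
  shows "(\<integral>\<^sup>+x. f (a + x) \<partial>M) = (\<integral>\<^sup>+x. f x \<partial>M)"
proof -
  have "(\<lambda>x. a + x) \<in> M \<rightarrow>\<^sub>M M"
    unfolding measurable_cong_sets[OF sets_M sets_M]
    by (intro borel_measurable_continuous_onI continuous_intros)
  then have "(\<integral>\<^sup>+x. f x \<partial>distr M M (\<lambda>x. a + x)) = (\<integral>\<^sup>+x. f (a + x) \<partial>M)"
    using assms by (intro nn_integral_distr) (auto simp: measurable_M_iff)
  then show ?thesis
    by (simp add: distr_translate)
qed

lemma translate_right:
  "E \<in> sets borel \<Longrightarrow> emeasure M ((\<lambda>x. x + a) -` E) = emeasure M E"
  using translate[of E a] by (simp add: add.commute)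

lemma outer_measure_of_translate_le:
  "outer_measure_of M ((\<lambda>x. a + x) -` E) \<le> outer_measure_of M E"
proof -
  obtain E' where E': "E' \<in> sets M" "E \<subseteq> E'" "outer_measure_of M E = emeasure M E'"
    using outer_measure_of_attain[of E M] by auto
  have "(\<lambda>x. a + x) -` E' \<in> sets M"
    using E'(1) measurable_sets[of "\<lambda>x. a + x" borel borel E'] unfolding sets_M
    by (auto intro!: borel_measurable_continuous_onI continuous_intros)
  then have "outer_measure_of M ((\<lambda>x. a + x) -` E) \<le> emeasure M ((\<lambda>x. a + x) -` E')"
    using outer_measure_of_mono[of "(\<lambda>x. a + x) -` E" "(\<lambda>x. a + x) -` E'" M] E'(2) by auto
  then show ?thesis
    using E' translate by (simp add: sets_M)
qed

lemma outer_measure_of_translate: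
  "outer_measure_of M ((\<lambda>x. a + x) -` E) = outer_measure_of M E"
proof (rule antisym)
  show "outer_measure_of M E \<le> outer_measure_of M ((\<lambda>x. a + x) -` E)"
    using outer_measure_of_translate_le[of "- a" "(\<lambda>x. a + x) -` E"] by (simp add: vimage_def)
qed (rule outer_measure_of_translate_le)

subsection \<open>Vanishing proportions along the filtration\<close>

text \<open>The sets may change with \<open>j\<close> in more than the intersection with
  \<open>B j\<close>, because error bounds will refer to the radius \<open>\<rho> ^ j\<close>. The
  outer measure accommodates arbitrary sets, as the notion of density does.\<close>

definition vanishing :: "(nat \<Rightarrow> 'a set) \<Rightarrow> bool" where
  "vanishing S \<longleftrightarrow>
     (\<forall>e>0. \<forall>\<^sub>F j in sequentially. outer_measure_of M (S j) \<le> ennreal e * emeasure M (B j))"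

lemma vanishing_mono:
  assumes "vanishing T" "\<forall>\<^sub>F j in sequentially. S j \<subseteq> T j"
  shows "vanishing S"
  unfolding vanishing_def
proof (intro allI impI)
  fix e :: real assume "e > 0"
  then have "\<forall>\<^sub>F j in sequentially. outer_measure_of M (T j) \<le> ennreal e * emeasure M (B j)"
    using assms(1) unfolding vanishing_def by blast
  then show "\<forall>\<^sub>F j in sequentially. outer_measure_of M (S j) \<le> ennreal e * emeasure M (B j)"
    using assms(2) by eventually_elim (meson order_trans outer_measure_of_mono)
qed

lemma vanishing_mono': "vanishing T \<Longrightarrow> (\<And>j. S j \<subseteq> T j) \<Longrightarrow> vanishing S"
  by (erule vanishing_mono) simp

lemma vanishing_Un:
  assumes "vanishing S" "vanishing T"
  shows "vanishing (\<lambda>j. S j \<union> T j)"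
  unfolding vanishing_def
proof (intro allI impI)
  fix e :: real assume e: "e > 0"
  then have "\<forall>\<^sub>F j in sequentially. outer_measure_of M (S j) \<le> ennreal (e / 2) * emeasure M (B j)"
    "\<forall>\<^sub>F j in sequentially. outer_measure_of M (T j) \<le> ennreal (e / 2) * emeasure M (B j)"
    using assms unfolding vanishing_def by (auto dest!: spec[of _ "e / 2"])
  then show "\<forall>\<^sub>F j in sequentially. outer_measure_of M (S j \<union> T j) \<le> ennreal e * emeasure M (B j)"
  proof eventually_elim
    case (elim j)
    have "outer_measure_of M (S j \<union> T j) \<le> outer_measure_of M (S j) + outer_measure_of M (T j)"
      by (rule outer_measure_of_Un_le) auto
    also have "\<dots> \<le> ennreal (e / 2) * emeasure M (B j) + ennreal (e / 2) * emeasure M (B j)"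
      by (intro add_mono elim)
    also have "\<dots> = ennreal e * emeasure M (B j)"
      using e by (simp flip: distrib_right ennreal_plus)
    finally show ?case .
  qed
qed

lemma vanishing_empty [simp]: "vanishing (\<lambda>j. {})"
  by (simp add: vanishing_def)

lemma vanishing_shift:
  assumes "vanishing S"
  shows "vanishing (\<lambda>j. S (j + n))"
  unfolding vanishing_def
proof (intro allI impI)
  fix e :: real assume e: "e > 0"
  then have "\<forall>\<^sub>F j in sequentially. outer_measure_of M (S (j + n)) \<le> ennreal e * emeasure M (B (j + n))"
    using assms unfolding vanishing_def by (subst eventually_sequentially_seg) auto
  then show "\<forall>\<^sub>F j in sequentially. outer_measure_of M (S (j + n)) \<le> ennreal e * emeasure M (B j)"
  proof eventually_elim
    case (elim j)
    have "emeasure M (B (j + n)) \<le> emeasure M (B j)"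
      using B_antimono[of j "j + n"] by (intro emeasure_mono) auto
    then show ?case
      using elim by (meson mult_left_mono order_trans zero_le)
  qed
qed

lemma vanishing_UN_shift:
  assumes "vanishing S"
  shows "vanishing (\<lambda>j. \<Union>i<n. S (j + i))"
proof (induction n)
  case (Suc n)
  then show ?case
    using vanishing_Un[OF vanishing_shift[OF assms, of n] Suc] by (simp add: lessThan_Suc)
qed simp

text \<open>\<open>E \<inter> B j\<close> is covered by the shells \<open>S j\<close>, ...,
  \<open>S (j + n - 1)\<close> and the core \<open>B (j + n)\<close>, whose share of
  \<open>B j\<close> is \<open>c ^ n\<close>. Choosing \<open>n\<close> by the tolerance leaves a
  fixed finite number of shells. This turns a bound relative to the radius into one relative to the
  norm.\<close>

lemma vanishing_shells:
  assumes S: "vanishing S" and sub: "\<And>j. E \<inter> (B j - B (Suc j)) \<subseteq> S j"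
  shows "vanishing (\<lambda>j. E \<inter> B j)"
  unfolding vanishing_def
proof (intro allI impI)
  fix e :: real assume e: "e > 0"
  have "(\<lambda>n. c ^ n) \<longlonglongrightarrow> 0"
    using c by (intro LIMSEQ_realpow_zero) auto
  then have "\<forall>\<^sub>F n in sequentially. c ^ n < e / 2"
    using e by (intro order_tendstoD) auto
  then obtain n where n: "c ^ n \<le> e / 2"
    by (auto simp: eventually_sequentially intro: less_imp_le)
  have "\<forall>\<^sub>F j in sequentially. outer_measure_of M (\<Union>i<n. S (j + i)) \<le> ennreal (e / 2) * emeasure M (B j)"
    using vanishing_UN_shift[OF S, of n] e unfolding vanishing_def by auto
  then show "\<forall>\<^sub>F j in sequentially. outer_measure_of M (E \<inter> B j) \<le> ennreal e * emeasure M (B j)"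
  proof eventually_elim
    case (elim j)
    have sub': "E \<inter> B j \<subseteq> (\<Union>i<k. S (j + i)) \<union> B (j + k)" for k
    proof (induction k)
      case (Suc k)
      show ?case
      proof
        fix v assume v: "v \<in> E \<inter> B j"
        show "v \<in> (\<Union>i<Suc k. S (j + i)) \<union> B (j + Suc k)"
        proof (cases "v \<in> B (j + k) \<and> v \<notin> B (j + Suc k)")
          case True
          then have "v \<in> S (j + k)"
            using v sub[of "j + k"] by auto
          then show ?thesis
            by auto
        next
          case False
          then consider "v \<in> B (j + Suc k)" | "v \<in> (\<Union>i<k. S (j + i))"
            using v Suc by blast
          then show ?thesis
            by cases (auto simp: lessThan_Suc)
        qed
      qed
    qed auto
    have "outer_measure_of M (E \<inter> B j) \<le> outer_measure_of M ((\<Union>i<n. S (j + i)) \<union> B (j + n))"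
      by (rule outer_measure_of_mono[OF sub'])
    also have "\<dots> \<le> outer_measure_of M (\<Union>i<n. S (j + i)) + outer_measure_of M (B (j + n))"
      by (rule outer_measure_of_Un_le) auto
    also have "\<dots> \<le> ennreal (e / 2) * emeasure M (B j) + ennreal (e / 2) * emeasure M (B j)"
      using elim n by (intro add_mono) (auto simp: emeasure_B_add intro!: mult_right_mono ennreal_leI)
    also have "\<dots> = ennreal e * emeasure M (B j)"
      using e by (simp flip: distrib_right ennreal_plus)
    finally show ?case .
  qed
qed

text \<open>Density zero at the origin, tested only on the radii \<open>\<rho> ^ j\<close>;
  \<open>density_zero_iff\<close> shows that this agrees with all radii.\<close>

definition null_density :: "'a set \<Rightarrow> bool" where
  "null_density E \<longleftrightarrow> vanishing (\<lambda>j. E \<inter> B j)"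

lemma null_density_mono: "null_density F \<Longrightarrow> E \<subseteq> F \<Longrightarrow> null_density E"
  unfolding null_density_def by (erule vanishing_mono') auto

lemma null_density_Un: "null_density E \<Longrightarrow> null_density F \<Longrightarrow> null_density (E \<union> F)"
  unfolding null_density_def by (drule (1) vanishing_Un) (simp add: Int_Un_distrib2)

lemma null_density_null_set:
  assumes "Z \<in> null_sets M"
  shows "null_density Z"
proof -
  have "outer_measure_of M (Z \<inter> B j) \<le> outer_measure_of M Z" for j
    by (rule outer_measure_of_mono) auto
  then show ?thesis
    using assms by (simp add: null_density_def vanishing_def null_sets_def)
qed

text \<open>Otherwise the tolerance 1/2 would contradict that \<open>B j\<close> has positive finite
  measure. Points outside exceptional sets are obtained from this fact, notably in the uniqueness
  proofs.\<close>

lemma vanishing_not_B: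
  assumes "vanishing S"
  shows "\<exists>j. \<not> B j \<subseteq> S j"
proof (rule ccontr)
  assume "\<not> ?thesis"
  then have sub: "B j \<subseteq> S j" for j
    by blast
  have "\<forall>\<^sub>F j in sequentially. outer_measure_of M (S j) \<le> ennreal (1 / 2) * emeasure M (B j)"
    using assms unfolding vanishing_def by (auto simp del: ennreal_half)
  then obtain j where j: "outer_measure_of M (S j) \<le> ennreal (1 / 2) * emeasure M (B j)"
    by (auto simp: eventually_sequentially)
  have "ennreal 1 * emeasure M (B j) \<le> ennreal (1 / 2) * emeasure M (B j)"
    using order_trans[OF outer_measure_of_mono[OF sub[of j], of M] j] by simp
  then show False
    using emeasure_B_pos[of j] emeasure_B_finite[of j]
    by (subst (asm) ennreal_mult_right_cong) (auto simp: ennreal_mult_le_mult_iff mult.commute[of _ "emeasure M (B j)"] simp del: ennreal_1 ennreal_half)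
qed

lemma null_density_not_UNIV: "\<not> null_density UNIV"
  unfolding null_density_def using vanishing_not_B by fastforce

text \<open>A small radius \<open>R\<close> satisfies \<open>\<rho> ^ Suc j < R\<close> and
  \<open>R \<le> \<rho> ^ j\<close> for some \<open>j\<close>. Enlarging the numerator to radius
  \<open>\<rho> ^ j\<close> and shrinking the denominator to \<open>\<rho> ^ Suc j\<close> costs the
  constant factor \<open>c\<close>, which the tolerance \<open>e * c\<close> pays for.\<close>

lemma density_zero_iff: "density_zero M N E x \<longleftrightarrow> null_density ((\<lambda>v. x + v) -` E)"
proof -
  define b where "b R = {v. N v \<le> R}" for R
  have b: "0 < emeasure M (b R)" "emeasure M (b R) < top" if "R > 0" for R
    using that emeasure_ball_pos emeasure_ball_finite by (auto simp: b_def)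
  define E' where "E' = (\<lambda>v. x + v) -` E"
  have ball: "(\<lambda>v. x + v) -` norm_cball N x R = b R" for R
    by (auto simp: norm_cball_def b_def)
  have cball_borel: "norm_cball N x R \<in> sets borel" for R
  proof -
    have "norm_cball N x R = (\<lambda>z. - x + z) -` b R \<inter> space borel"
      by (auto simp: norm_cball_def b_def)
    also have "\<dots> \<in> sets borel"
      unfolding b_def
      by (intro measurable_sets[OF _ N_ball_borel] borel_measurable_continuous_onI continuous_intros)
    finally show ?thesis .
  qed
  have "outer_measure_of M (E \<inter> norm_cball N x R) = outer_measure_of M (E' \<inter> b R)"
    and "emeasure M (norm_cball N x R) = emeasure M (b R)" for R
    using outer_measure_of_translate[of x "E \<inter> norm_cball N x R"]
      translate[OF cball_borel, of x R] by (simp_all add: ball E'_def)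
  then have "density_zero M N E x \<longleftrightarrow>
      (\<forall>e>0. \<forall>\<^sub>F R in at_right 0. outer_measure_of M (E' \<inter> b R) / emeasure M (b R) \<le> ennreal e)"
    unfolding density_zero_def by (simp add: ennreal_tendsto_0_iff)
  also have "\<dots> \<longleftrightarrow>
      (\<forall>e>0. \<forall>\<^sub>F R in at_right 0. outer_measure_of M (E' \<inter> b R) \<le> ennreal e * emeasure M (b R))"
  proof (intro all_cong1 imp_cong refl eventually_cong)
    show "\<forall>\<^sub>F R in at_right 0. (0::real) < R"
      by (rule eventually_at_right_less)
  qed (use b in \<open>simp add: ennreal_divide_le_iff\<close>)
  also have "\<dots> \<longleftrightarrow> null_density E'"
  proof
    assume *: "\<forall>e>0. \<forall>\<^sub>F R in at_right 0. outer_measure_of M (E' \<inter> b R) \<le> ennreal e * emeasure M (b R)"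
    have "filterlim (\<lambda>j. \<rho> ^ j) (at_right 0) sequentially"
      using rho unfolding filterlim_at by (auto intro!: LIMSEQ_realpow_zero)
    then have "filterlim (\<lambda>j. \<rho> ^ j) (at_right 0) sequentially"
      by simp
    from filterlim_iff[THEN iffD1, OF this] * show "null_density E'"
      unfolding null_density_def vanishing_def B_def b_def by blast
  next
    assume nd: "null_density E'"
    show "\<forall>e>0. \<forall>\<^sub>F R in at_right 0. outer_measure_of M (E' \<inter> b R) \<le> ennreal e * emeasure M (b R)"
    proof (intro allI impI)
      fix e :: real assume e: "e > 0"
      have "\<forall>\<^sub>F j in sequentially. outer_measure_of M (E' \<inter> B j) \<le> ennreal (e * c) * emeasure M (B j)"
        using nd e c unfolding null_density_def vanishing_def by auto
      then obtain J where J: "\<And>j. j \<ge> J \<Longrightarrow> outer_measure_of M (E' \<inter> B j) \<le> ennreal (e * c) * emeasure M (B j)"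
        by (auto simp: eventually_sequentially)
      have "outer_measure_of M (E' \<inter> b R) \<le> ennreal e * emeasure M (b R)"
        if R: "0 < R" "R < \<rho> ^ J" for R
      proof -
        have "(\<lambda>n. \<rho> ^ n) \<longlonglongrightarrow> 0"
          using rho by (intro LIMSEQ_realpow_zero) auto
        then have "\<forall>\<^sub>F n in sequentially. \<rho> ^ n < R"
          using R by (intro order_tendstoD) auto
        then have ex: "\<exists>n. \<rho> ^ n < R"
          by (auto simp: eventually_sequentially)
        \<comment> \<open>The least such exponent is the outer index \<open>Suc j\<close>:
          minimality gives \<open>R \<le> \<rho> ^ j\<close>, and \<open>R < \<rho> ^ J\<close>
          ensures that \<open>j\<close> has already passed the threshold \<open>J\<close>.\<close>
        define n where "n = (LEAST n. \<rho> ^ n < R)"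
        have n: "\<rho> ^ n < R"
          unfolding n_def using ex by (rule LeastI_ex)
        have "n > J"
        proof (rule ccontr)
          assume "\<not> n > J"
          then have "\<rho> ^ J \<le> \<rho> ^ n"
            using rho by (intro power_decreasing) auto
          then show False
            using n R by simp
        qed
        then obtain j where j: "n = Suc j" "j \<ge> J"
          by (metis Suc_le_eq Suc_le_mono less_imp_Suc_add add_Suc_right less_Suc_eq_le)
        have R': "R \<le> \<rho> ^ j"
          using not_less_Least[of j "\<lambda>n. \<rho> ^ n < R"] j by (auto simp: n_def)
        have "outer_measure_of M (E' \<inter> b R) \<le> outer_measure_of M (E' \<inter> B j)"
          using R' by (intro outer_measure_of_mono) (auto simp: b_def B_def)
        also have "\<dots> \<le> ennreal (e * c) * emeasure M (B j)"
          using J j by simp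
        also have "\<dots> = ennreal e * emeasure M (B (Suc j))"
          using emeasure_B_add[of j 1] e c by (simp add: ennreal_mult mult.assoc)
        also have "\<dots> \<le> ennreal e * emeasure M (b R)"
          using n j N_ball_borel by (intro mult_left_mono emeasure_mono) (auto simp: b_def B_def sets_M)
        finally show ?thesis .
      qed
      then show "\<forall>\<^sub>F R in at_right 0. outer_measure_of M (E' \<inter> b R) \<le> ennreal e * emeasure M (b R)"
        using rho unfolding eventually_at_right_field by (intro exI[of _ "\<rho> ^ J"]) auto
    qed
  qed
  finally show ?thesis
    by (simp add: E'_def)
qed

lemma density_zero_completion_iff: 
  "density_zero (completion M) N E x \<longleftrightarrow> null_density ((\<lambda>v. x + v) -` E)"
proof -
  have "norm_cball N x R \<in> sets M" for R
  proof -
    have "norm_cball N x R = (\<lambda>z. - x + z) -` {v. N v \<le> R} \<inter> space borel"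
      by (auto simp: norm_cball_def)
    also have "\<dots> \<in> sets borel"
      by (intro measurable_sets[OF _ N_ball_borel] borel_measurable_continuous_onI continuous_intros)
    finally show ?thesis
      by (simp add: sets_M)
  qed
  then show ?thesis
    unfolding density_zero_iff[symmetric] density_zero_def by (simp add: outer_measure_of_completion)
qed

lemma vanishingI_nat:
  assumes "\<And>l::nat. \<forall>\<^sub>F j in sequentially. outer_measure_of M (S j) \<le> ennreal (1 / Suc l) * emeasure M (B j)"
  shows "vanishing S"
  unfolding vanishing_def
proof (intro allI impI)
  fix e :: real assume "e > 0"
  then obtain l where l: "1 / Suc l < e"
    using nat_approx_posE by blast
  show "\<forall>\<^sub>F j in sequentially. outer_measure_of M (S j) \<le> ennreal e * emeasure M (B j)"
    using assms[of l]
  proof eventually_elim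
    case (elim j)
    also have "ennreal (1 / Suc l) * emeasure M (B j) \<le> ennreal e * emeasure M (B j)"
      using l by (intro mult_right_mono ennreal_leI) auto
    finally show ?case .
  qed
qed

section \<open>Maximal inequality and density theorem along an additive map\<close>

lemma measurable_translates:
  fixes P :: "'a \<Rightarrow> 'a"
  assumes [measurable]: "E \<in> sets borel" "P \<in> borel \<rightarrow>\<^sub>M borel"
  shows "(\<lambda>x. emeasure M {v\<in>B j. x + P v \<in> E}) \<in> borel_measurable borel"
proof (rule measurable_emeasure)
  have "{x \<in> space (borel \<Otimes>\<^sub>M M). snd x \<in> {v \<in> B j. fst x + P v \<in> E}} =
      {x \<in> space (borel \<Otimes>\<^sub>M borel). snd x \<in> B j \<and> fst x + P (snd x) \<in> E}"
    by (simp add: space_pair_measure)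
  also have "\<dots> \<in> sets (borel \<Otimes>\<^sub>M borel)"
    by measurable
  finally show "{x \<in> space (borel \<Otimes>\<^sub>M M). snd x \<in> {v \<in> B j. fst x + P v \<in> E}} \<in> sets (borel \<Otimes>\<^sub>M M)"
    using sets_pair_measure_cong[OF refl sets_M] by blast
qed simp

text \<open>By Fubini, \<open>x\<close> is integrated first. For fixed \<open>v\<close> in
  \<open>B j\<close>, translation by \<open>P v\<close> preserves both the measure and
  \<open>H\<close>, so each \<open>v\<close> contributes the measure of \<open>H \<inter> E\<close>.
  The average runs over the full ball in \<open>v\<close> even if the range of \<open>P\<close> is
  null.\<close>

lemma nn_integral_translates:
  fixes P :: "'a \<Rightarrow> 'a"
  assumes E [measurable]: "E \<in> sets borel" and P [measurable]: "P \<in> borel \<rightarrow>\<^sub>M borel"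
    and H [measurable]: "H \<in> sets borel" and inv: "\<And>x v. v \<in> B j \<Longrightarrow> x + P v \<in> H \<longleftrightarrow> x \<in> H"
  shows "(\<integral>\<^sup>+x\<in>H. emeasure M {v\<in>B j. x + P v \<in> E} \<partial>M) = emeasure M (B j) * emeasure M (H \<inter> E)"
proof -
  interpret MM: pair_sigma_finite M M ..
  note [measurable_cong] = sets_M
  define f where "f x v = (indicator (B j) v * indicator H x * indicator E (x + P v) :: ennreal)" for x v
  have f [measurable]: "case_prod f \<in> borel_measurable (M \<Otimes>\<^sub>M M)"
    unfolding f_def by measurable
  have "(\<integral>\<^sup>+x\<in>H. emeasure M {v\<in>B j. x + P v \<in> E} \<partial>M) = (\<integral>\<^sup>+x. \<integral>\<^sup>+v. f x v \<partial>M \<partial>M)"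
  proof (intro nn_integral_cong)
    fix x
    have "(\<integral>\<^sup>+v. f x v \<partial>M) = (\<integral>\<^sup>+v. indicator H x * indicator {v\<in>B j. x + P v \<in> E} v \<partial>M)"
      by (intro nn_integral_cong) (auto simp: f_def indicator_def)
    also have "\<dots> = indicator H x * emeasure M {v\<in>B j. x + P v \<in> E}"
      by (subst nn_integral_cmult_indicator) auto
    finally show "emeasure M {v\<in>B j. x + P v \<in> E} * indicator H x = (\<integral>\<^sup>+v. f x v \<partial>M)"
      by (simp add: mult.commute)
  qed
  also have "\<dots> = (\<integral>\<^sup>+v. \<integral>\<^sup>+x. f x v \<partial>M \<partial>M)"
    by (rule MM.Fubini'[OF f, symmetric])
  also have "\<dots> = (\<integral>\<^sup>+v. indicator (B j) v * emeasure M (H \<inter> E) \<partial>M)"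
  proof (intro nn_integral_cong)
    fix v
    have "(\<integral>\<^sup>+x. f x v \<partial>M) = (\<integral>\<^sup>+x. indicator (B j) v * indicator (H \<inter> E) (P v + x) \<partial>M)"
      using inv by (intro nn_integral_cong) (auto simp: f_def indicator_def add.commute)
    also have "\<dots> = indicator (B j) v * (\<integral>\<^sup>+x. indicator (H \<inter> E) (P v + x) \<partial>M)"
      by (intro nn_integral_cmult) measurable
    also have "(\<integral>\<^sup>+x. indicator (H \<inter> E) (P v + x) \<partial>M) = emeasure M (H \<inter> E)"
      by (subst nn_integral_translate) auto
    finally show "(\<integral>\<^sup>+x. f x v \<partial>M) = indicator (B j) v * emeasure M (H \<inter> E)" .
  qed
  also have "\<dots> = emeasure M (B j) * emeasure M (H \<inter> E)"
    by (subst nn_integral_multc) auto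
  finally show ?thesis .
qed

lemma maximal_inequality:
  fixes P :: "'a \<Rightarrow> 'a"
  assumes E [measurable]: "E \<in> sets borel" and P [measurable]: "P \<in> borel \<rightarrow>\<^sub>M borel"
    and P_add: "\<And>v w. P (v + w) = P v + P w"
    and l: "l > 0"
  defines "S \<equiv> {x. \<exists>j. ennreal l * emeasure M (B j) < emeasure M {v\<in>B j. x + P v \<in> E}}"
  shows "S \<in> sets borel" "ennreal l * emeasure M S \<le> emeasure M E"
proof -
  define T where "T j x = emeasure M {v\<in>B j. x + P v \<in> E}" for j x
  have T [measurable]: "T j \<in> borel_measurable borel" for j
    unfolding T_def by (rule measurable_translates[OF E P])
  \<comment> \<open>Invariance is required for all i \<le> j, not only for \<open>j\<close>, because
    \<open>H j\<close> also excludes the earlier sets \<open>G i\<close>.\<close>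
  have T_inv: "T i (x + P u) = T i x" if "u \<in> B j" "i \<le> j" for i j x u
  proof -
    have u: "u \<in> B i"
      using that B_antimono by blast
    have "{v\<in>B i. x + P v \<in> E} \<in> sets borel"
      by measurable
    then have "T i x = emeasure M ((\<lambda>v. u + v) -` {v\<in>B i. x + P v \<in> E})"
      unfolding T_def by (rule translate[symmetric])
    also have "(\<lambda>v. u + v) -` {v\<in>B i. x + P v \<in> E} = {v\<in>B i. x + P u + P v \<in> E}"
      using B_add_iff[OF u] by (auto simp: P_add add.assoc)
    finally show ?thesis
      by (simp add: T_def)
  qed
  define G where "G j = {x. ennreal l * emeasure M (B j) < T j x}" for j
  have G [measurable]: "G j \<in> sets borel" for j
  proof -
    have "{x\<in>space borel. ennreal l * emeasure M (B j) < T j x} \<in> sets borel"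
      by measurable
    then show ?thesis by (simp add: G_def)
  qed
  define H where "H j = G j - (\<Union>i<j. G i)" for j
  have H [measurable]: "H j \<in> sets borel" for j
    unfolding H_def by measurable
  have S_eq: "S = (\<Union>j. H j)"
  proof -
    have "S = (\<Union>j. G j)"
      by (auto simp: S_def G_def T_def)
    also have "\<dots> = (\<Union>j. H j)"
      unfolding H_def using UN_disjointed_eq[of G] by (simp add: disjointed_def atLeast0LessThan)
    finally show ?thesis .
  qed
  show "S \<in> sets borel"
    unfolding S_eq by measurable
  have disj: "disjoint_family H"
    using disjoint_family_disjointed[of G] by (simp add: H_def[abs_def] disjointed_def[abs_def] atLeast0LessThan)
  \<comment> \<open>The inequality defining \<open>G j\<close> is integrated over
    \<open>H j\<close>, and the measure of \<open>B j\<close>, positive and finite, is cancelled. As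
    the sets \<open>H j\<close> are disjoint, summation gives the maximal inequality with constant
    1.\<close>
  have le: "ennreal l * emeasure M (H j) \<le> emeasure M (H j \<inter> E)" for j
  proof -
    have "(ennreal l * emeasure M (B j)) * emeasure M (H j) = (\<integral>\<^sup>+x. (ennreal l * emeasure M (B j)) * indicator (H j) x \<partial>M)"
      by (simp add: nn_integral_cmult_indicator sets_M)
    also have "\<dots> \<le> (\<integral>\<^sup>+x\<in>H j. emeasure M {v\<in>B j. x + P v \<in> E} \<partial>M)"
      by (intro nn_integral_mono) (auto simp: H_def G_def T_def indicator_def)
    also have "\<dots> = emeasure M (B j) * emeasure M (H j \<inter> E)"
    proof (intro nn_integral_translates E P H)
      fix x v assume v: "v \<in> B j"
      then show "x + P v \<in> H j \<longleftrightarrow> x \<in> H j"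
        unfolding H_def G_def by (auto simp: T_inv[OF v])
    qed
    finally have "emeasure M (B j) * (ennreal l * emeasure M (H j)) \<le> emeasure M (B j) * emeasure M (H j \<inter> E)"
      by (simp add: mult_ac)
    then show ?thesis
      using emeasure_B_pos[of j] emeasure_B_finite[of j] by (simp add: ennreal_mult_le_mult_iff)
  qed
  have "ennreal l * emeasure M S = (\<Sum>j. ennreal l * emeasure M (H j))"
    unfolding S_eq ennreal_suminf_cmult
    using H disj by (subst suminf_emeasure) (auto simp: sets_M)
  also have "\<dots> \<le> (\<Sum>j. emeasure M (H j \<inter> E))"
    by (intro suminf_le le) auto
  also have "\<dots> = emeasure M (\<Union>j. H j \<inter> E)"
    using disj by (intro suminf_emeasure) (auto simp: sets_M disjoint_family_on_def)
  also have "\<dots> \<le> emeasure M E"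
    by (intro emeasure_mono) (auto simp: sets_M)
  finally show "ennreal l * emeasure M S \<le> emeasure M E" .
qed

text \<open>Inner regularity by compact sets is available for finite measures, hence it is applied
  to the restriction \<open>L\<close> of \<open>M\<close> to \<open>E\<close>.\<close>

lemma exists_closed_subset:
  assumes E: "E \<in> sets borel" "emeasure M E < \<infinity>" and e: "e > (0::real)"
  shows "\<exists>F. closed F \<and> F \<subseteq> E \<and> emeasure M (E - F) \<le> ennreal e"
proof -
  define L where "L = density M (indicator E)"
  have L: "emeasure L A = emeasure M (E \<inter> A)" if "A \<in> sets borel" for A
    using that E unfolding L_def by (intro emeasure_restricted) (auto simp: sets_M)
  have "sets L = sets borel" "emeasure L (space L) \<noteq> \<infinity>"
    using E L[of UNIV] by (auto simp: L_def sets_M)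
  then have "emeasure L E = (SUP K\<in>{K. K \<subseteq> E \<and> compact K}. emeasure L K)"
    using E(1) by (rule inner_regular)
  then have sup: "(SUP K\<in>{K. K \<subseteq> E \<and> compact K}. emeasure L K) = emeasure M E"
    using L[OF E(1)] by simp
  show ?thesis
  \<comment> \<open>For a null set \<open>emeasure M E - ennreal e\<close> would not be strictly
    below \<open>emeasure M E\<close>, and no compact set could be extracted from the
    supremum.\<close>
  proof (cases "emeasure M E = 0")
    case True
    then show ?thesis
      by (intro exI[of _ "{}"]) auto
  next
    case False
    have fin: "emeasure M E \<noteq> top"
      using E(2) by auto
    then have "emeasure M E - ennreal e < emeasure M E"
      using False e ennreal_between[of "ennreal e" "emeasure M E"] by (simp add: zero_less_iff_neq_zero less_top[symmetric])
    then obtain K where K: "K \<subseteq> E" "compact K" "emeasure M E - ennreal e < emeasure L K"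
      unfolding sup[symmetric] less_SUP_iff by blast
    have Kb: "K \<in> sets borel"
      using K(2) by (simp add: compact_imp_closed borel_closed)
    have LK: "emeasure L K = emeasure M K"
      using L[OF Kb] K(1) by (simp add: inf.absorb2)
    have "emeasure M (E - K) = emeasure M E - emeasure M K"
      using K(1) Kb E fin emeasure_mono[of K E M] by (intro emeasure_Diff) (auto simp: sets_M top_unique)
    also have "\<dots> \<le> ennreal e"
      using less_imp_le[OF K(3)] fin unfolding LK by (simp add: ennreal_minus_le_iff add.commute)
    finally show ?thesis
      using K by (auto intro: compact_imp_closed)
  qed
qed

text \<open>Approximate \<open>E\<close> from inside by closed sets \<open>F n\<close>. A point
  outside \<open>E\<close> has a neighbourhood missing \<open>F n\<close>, so near it only
  \<open>E - F n\<close> counts. The maximal inequality makes the set of points with a large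
  proportion of \<open>E - F n\<close> as small as \<open>1 / Suc n\<close> permits; the points bad
  for every \<open>n\<close> form a null set.\<close>

lemma AE_vanishing_finite:
  fixes P :: "'a \<Rightarrow> 'a"
  assumes E [measurable]: "E \<in> sets borel" and fin: "emeasure M E < \<infinity>"
    and P [measurable]: "P \<in> borel \<rightarrow>\<^sub>M borel"
    and P_add: "\<And>v w. P (v + w) = P v + P w" and P_N: "\<And>v. N (P v) \<le> N v"
  shows "AE x in M. x \<notin> E \<longrightarrow> vanishing (\<lambda>j. {v\<in>B j. x + P v \<in> E})"
proof -
  have "AE x in M. x \<notin> E \<longrightarrow>
      (\<forall>\<^sub>F j in sequentially. emeasure M {v\<in>B j. x + P v \<in> E} \<le> ennreal l * emeasure M (B j))"
    if l: "l > 0" for l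
  proof -
    define S where "S F = {x. \<exists>j. ennreal l * emeasure M (B j) < emeasure M {v\<in>B j. x + P v \<in> E - F}}" for F
    have "\<exists>F. closed F \<and> F \<subseteq> E \<and> emeasure M (E - F) \<le> ennreal (1 / Suc n)" for n :: nat
      by (intro exists_closed_subset E fin) simp
    then obtain F where F: "\<And>n. closed (F n)" "\<And>n. F n \<subseteq> E" "\<And>n::nat. emeasure M (E - F n) \<le> ennreal (1 / Suc n)"
      by metis
    have [measurable]: "F n \<in> sets borel" for n
      using F(1) by (rule borel_closed)
    have S: "S (F n) \<in> sets borel" "ennreal l * emeasure M (S (F n)) \<le> emeasure M (E - F n)" for n
      unfolding S_def by (intro maximal_inequality P P_add l; measurable)+
    have "(\<Inter>n. S (F n)) \<in> null_sets M"
    proof (rule null_setsI)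
      show "(\<Inter>n. S (F n)) \<in> sets M"
        using S(1) by (simp add: sets_M)
      have "ennreal l * emeasure M (\<Inter>n. S (F n)) \<le> ennreal (1 / Suc n)" for n :: nat
      proof -
        have "ennreal l * emeasure M (\<Inter>n. S (F n)) \<le> ennreal l * emeasure M (S (F n))"
          using S(1) by (intro mult_left_mono emeasure_mono) (auto simp: sets_M)
        then show ?thesis
          using S(2)[of n] F(3)[of n] by (meson order_trans)
      qed
      moreover have "(\<lambda>n. ennreal (1 / Suc n)) \<longlonglongrightarrow> ennreal 0"
        by (intro tendsto_ennrealI LIMSEQ_Suc[OF lim_1_over_n])
      ultimately have "ennreal l * emeasure M (\<Inter>n. S (F n)) \<le> ennreal 0"
        by (intro LIMSEQ_le_const) auto
      then show "emeasure M (\<Inter>n. S (F n)) = 0"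
        using l by simp
    qed
    then show ?thesis
    proof (rule AE_I')
      show "{x\<in>space M. \<not> (x \<notin> E \<longrightarrow> (\<forall>\<^sub>F j in sequentially.
        emeasure M {v\<in>B j. x + P v \<in> E} \<le> ennreal l * emeasure M (B j)))} \<subseteq> (\<Inter>n. S (F n))"
      proof (rule ccontr)
        assume "\<not> ?thesis"
        then obtain x n where x: "x \<notin> E" "x \<notin> S (F n)"
          "\<not> (\<forall>\<^sub>F j in sequentially. emeasure M {v\<in>B j. x + P v \<in> E} \<le> ennreal l * emeasure M (B j))"
          by blast
        have "\<forall>\<^sub>F j in sequentially. \<forall>v\<in>B j. x + v \<in> - F n"
          using x(1) F(1,2) by (intro B_tendsto_0) auto
        then have "\<forall>\<^sub>F j in sequentially. emeasure M {v\<in>B j. x + P v \<in> E} \<le> ennreal l * emeasure M (B j)"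
        proof eventually_elim
          case (elim j)
          have "P v \<in> B j" if "v \<in> B j" for v
            using that P_N[of v] by (auto simp: B_def)
          then have "{v\<in>B j. x + P v \<in> E} = {v\<in>B j. x + P v \<in> E - F n}"
            using elim by auto
          then show ?case
            using x(2) by (simp add: S_def not_less)
        qed
        with x(3) show False by blast
      qed
    qed
  qed
  then have "AE x in M. \<forall>n::nat. x \<notin> E \<longrightarrow> (\<forall>\<^sub>F j in sequentially.
      emeasure M {v\<in>B j. x + P v \<in> E} \<le> ennreal (1 / Suc n) * emeasure M (B j))"
    by (subst AE_all_countable) auto
  then show ?thesis
  proof eventually_elim
    case (elim x)
    have "{v\<in>B j. x + P v \<in> E} \<in> sets M" for j
      unfolding sets_M by measurable
    then show ?case
      using elim by (auto intro!: vanishingI_nat)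
  qed
qed

text \<open>The complement of \<open>C\<close> may have infinite measure and is cut down to balls of
  radius \<open>n\<close>. For \<open>n\<close> at least \<open>N x\<close> and 1 the cut is
  invisible from \<open>x\<close>, since all points \<open>x + P v\<close> with \<open>v\<close> in
  some \<open>B j\<close> stay in that ball. With a coordinate projection as \<open>P\<close> this
  is the density theorem along slices.\<close>

theorem AE_vanishing_complement:
  fixes P :: "'a \<Rightarrow> 'a"
  assumes E [measurable]: "C \<in> sets borel"
    and P [measurable]: "P \<in> borel \<rightarrow>\<^sub>M borel"
    and P_add: "\<And>v w. P (v + w) = P v + P w" and P_N: "\<And>v. N (P v) \<le> N v"
  shows "AE x in M. x \<in> C \<longrightarrow> vanishing (\<lambda>j. {v\<in>B j. x + P v \<notin> C})"
proof -
  have "AE x in M. \<forall>n::nat. x \<notin> {v. N v \<le> n} - C \<longrightarrow> vanishing (\<lambda>j. {v\<in>B j. x + P v \<in> {v. N v \<le> n} - C})"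
  proof (subst AE_all_countable, intro allI AE_vanishing_finite P P_add P_N)
    fix n :: nat
    show "{v. N v \<le> n} - C \<in> sets borel"
      using N_ball_borel E by blast
    have "emeasure M ({v. N v \<le> n} - C) \<le> emeasure M {v. N v \<le> n}"
      using N_ball_borel by (intro emeasure_mono) (auto simp: sets_M)
    also have "\<dots> < \<infinity>"
      by (rule emeasure_ball_finite)
    finally show "emeasure M ({v. N v \<le> n} - C) < \<infinity>" .
  qed
  then show ?thesis
  proof eventually_elim
    case (elim x)
    obtain n :: nat where n: "N x \<le> n" "1 \<le> n"
      using real_arch_simple[of "max (N x) 1"] by auto
    have "x + P v \<in> {v. N v \<le> n}" if "v \<in> B j" for v j
    proof -
      have "\<rho> ^ j \<le> 1"
        using rho by (simp add: power_le_one)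
      then have "N (P v) \<le> n"
        using that P_N[of v] n(2) by (auto simp: B_def)
      then show ?thesis
        using N_add n(1) by auto
    qed
    then have sub: "{v\<in>B j. x + P v \<notin> C} \<subseteq> {v\<in>B j. x + P v \<in> {v. N v \<le> n} - C}" for j
      by auto
    show ?case
    proof
      assume "x \<in> C"
      then show "vanishing (\<lambda>j. {v\<in>B j. x + P v \<notin> C})"
        using vanishing_mono'[OF elim[rule_format] sub] by simp
    qed
  qed
qed

lemma singleton_null: "{0} \<in> null_sets M"
proof (rule null_setsI)
  show sets: "{0} \<in> sets M"
    by (simp add: sets_M)
  have le: "emeasure M {0} \<le> ennreal (c ^ j) * emeasure M (B 0)" for j
    using emeasure_mono[of "{0}" "B j" M] emeasure_B_add[of 0 j] by auto
  have "(\<lambda>j. emeasure M (B 0) * ennreal (c ^ j)) \<longlonglongrightarrow> emeasure M (B 0) * ennreal 0"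
    using c emeasure_B_finite[of 0]
    by (intro ennreal_tendsto_cmult tendsto_ennrealI LIMSEQ_realpow_zero) auto
  then have "emeasure M {0} \<le> 0"
    using le by (intro LIMSEQ_le_const) (auto simp: mult.commute)
  then show "emeasure M {0} = 0"
    by simp
qed

lemma null_density_singleton: "null_density {0}"
  by (rule null_density_null_set[OF singleton_null])

text \<open>With countably many tolerances the condition can pass through countable unions and
  intersections of Borel sets.\<close>

lemma vanishing_iff_nat:
  "vanishing S \<longleftrightarrow> (\<forall>l::nat. \<forall>\<^sub>F j in sequentially.
     outer_measure_of M (S j) \<le> ennreal (1 / Suc l) * emeasure M (B j))"
proof
  assume "vanishing S"
  then show "\<forall>l::nat. \<forall>\<^sub>F j in sequentially.
      outer_measure_of M (S j) \<le> ennreal (1 / Suc l) * emeasure M (B j)"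
    unfolding vanishing_def by (auto simp del: of_nat_Suc)
qed (blast intro: vanishingI_nat)

lemma vanishing_translate:
  assumes "vanishing S"
  shows "vanishing (\<lambda>j. (\<lambda>v. w j + v) -` S j)"
  using assms by (simp add: vanishing_def outer_measure_of_translate)

end

subsection \<open>Haar measure on vectors\<close>

lemma measurable_vec_lambda:
  "vec_lambda \<in> (\<Pi>\<^sub>M i\<in>UNIV. borel) \<rightarrow>\<^sub>M (borel :: ('k::{metric_space, second_countable_topology} ^ 'm) measure)"
proof -
  have "continuous_on UNIV (vec_lambda :: ('m \<Rightarrow> 'k) \<Rightarrow> 'k ^ 'm)"
    by (intro continuous_on_vec_lambda continuous_on_product_coordinates)
  then show ?thesis
    unfolding measurable_cong_sets[OF sets_PiM_equal_borel refl]
    by (rule borel_measurable_continuous_onI)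
qed

lemma borel_measurable_vecI [measurable (raw)]:
  fixes f :: "'a \<Rightarrow> 'm::finite \<Rightarrow> 'k::{metric_space, second_countable_topology}"
  assumes "\<And>i. (\<lambda>x. f x i) \<in> borel_measurable M"
  shows "(\<lambda>x. \<chi> i. f x i) \<in> borel_measurable M"
proof -
  have "f \<in> M \<rightarrow>\<^sub>M (\<Pi>\<^sub>M i\<in>UNIV. borel)"
    using assms by (intro measurable_PiM_single') (auto simp: space_PiM)
  then show ?thesis
    by (rule measurable_compose[OF _ measurable_vec_lambda])
qed

lemma borel_measurable_vec_nth [measurable (raw)]:
  fixes f :: "'a \<Rightarrow> 'k::{metric_space, second_countable_topology} ^ 'm"
  assumes "f \<in> borel_measurable M"
  shows "(\<lambda>x. f x $ i) \<in> borel_measurable M"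
  by (rule measurable_compose[OF assms])
    (intro borel_measurable_continuous_onI continuous_intros)

lemma borel_measurable_diff_group [measurable (raw)]:
  fixes f g :: "'a \<Rightarrow> 'b::{second_countable_topology, topological_ab_group_add}"
  assumes "f \<in> borel_measurable M" "g \<in> borel_measurable M"
  shows "(\<lambda>x. f x - g x) \<in> borel_measurable M"
  using assms by (rule borel_measurable_continuous_Pair) (intro continuous_intros)

lemma borel_measurable_vector_scalar_mult [measurable (raw)]:
  fixes c :: "'a \<Rightarrow> 'k::nonarch_local_field" and g :: "'a \<Rightarrow> 'k ^ 'n"
  assumes "c \<in> borel_measurable M" "g \<in> borel_measurable M"
  shows "(\<lambda>x. c x *s g x) \<in> borel_measurable M"
  using assms by (rule borel_measurable_continuous_Pair) (intro continuous_intros)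

lemma borel_measurable_absv [measurable (raw)]:
  fixes f :: "'a \<Rightarrow> 'k::nonarch_local_field"
  assumes "f \<in> borel_measurable M"
  shows "(\<lambda>x. absv (f x)) \<in> borel_measurable M"
  by (rule measurable_compose[OF assms])
    (intro borel_measurable_continuous_onI continuous_intros)

lemma borel_measurable_max_norm [measurable (raw)]:
  fixes f :: "'a \<Rightarrow> 'k::nonarch_local_field ^ 'm"
  assumes [measurable]: "f \<in> borel_measurable M"
  shows "(\<lambda>x. max_norm (f x)) \<in> borel_measurable M"
proof (rule borel_measurableI_le)
  fix r
  show "{x \<in> space M. max_norm (f x) \<le> r} \<in> sets M"
    unfolding max_norm_le_iff by measurable
qed

lemma sigma_finite_measureI_incseq:
  assumes "\<And>n::nat. C n \<in> sets M" "(\<Union>n. C n) = space M" "\<And>n. emeasure M (C n) \<noteq> \<infinity>"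
  shows "sigma_finite_measure M"
  by standard (use assms in \<open>auto intro!: exI[of _ "range C"]\<close>)

locale haar_field =
  fixes \<mu> :: "'k::nonarch_local_field measure" and p :: 'k
  assumes haar: "haar_measure \<mu>"
    and unit_ball: "emeasure \<mu> (cball 0 1) = 1"
    and modulus: "absv_is_modulus \<mu>"
    and p: "p \<noteq> 0" "absv p < 1"
begin

abbreviation \<rho> :: real where "\<rho> \<equiv> absv p"

lemma sets_mu: "sets \<mu> = sets borel"
  using haar by (simp add: haar_measure_def)

lemma space_mu: "space \<mu> = UNIV"
  using sets_eq_imp_space_eq[OF sets_mu] by simp

lemma absv_ball_eq_cball: "{v::'k. absv v \<le> r} = cball 0 r"
  by (auto simp: absv_dist)

lemma emeasure_mu_ball_finite: "emeasure \<mu> {v. absv v \<le> r} < \<infinity>"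
  using haar compact_cball_field[of 0 r] unfolding absv_ball_eq_cball haar_measure_def by blast

lemma sigma_finite_mu: "sigma_finite_measure \<mu>"
proof (rule sigma_finite_measureI_incseq)
  show "{v. absv v \<le> real n} \<in> sets \<mu>" for n
    by (simp add: absv_ball_eq_cball sets_mu)
  show "(\<Union>n. {v. absv v \<le> real n}) = space \<mu>"
    using real_arch_simple by (auto simp: space_mu)
  show "emeasure \<mu> {v. absv v \<le> real n} \<noteq> \<infinity>" for n
    using emeasure_mu_ball_finite[of "real n"] by auto
qed

text \<open>Multiplication by \<open>p\<close> maps the ball of radius \<open>r\<close> onto the
  ball of radius \<open>\<rho> * r\<close>, and \<open>absv\<close> is the modular function.\<close>

lemma emeasure_mu_scale:
  "emeasure \<mu> {v. absv v \<le> \<rho> * r} = ennreal \<rho> * emeasure \<mu> {v. absv v \<le> r}"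
proof -
  have "v \<in> (\<lambda>x. p * x) ` {v. absv v \<le> r}" if "absv v \<le> \<rho> * r" for v
  proof (rule image_eqI)
    show "v = p * (v / p)"
      using p(1) by simp
    have "absv v / \<rho> \<le> r"
      using that p(1) by (intro mult_imp_div_pos_le) (simp_all add: mult.commute[of r \<rho>])
    then show "v / p \<in> {v. absv v \<le> r}"
      by (simp add: absv_divide)
  qed
  moreover have "absv (p * x) \<le> \<rho> * r" if "absv x \<le> r" for x
    unfolding absv_mult using that by (intro mult_left_mono) auto
  ultimately have "{v. absv v \<le> \<rho> * r} = (\<lambda>x. p * x) ` {v. absv v \<le> r}"
    by blast
  also have "emeasure \<mu> \<dots> = ennreal \<rho> * emeasure \<mu> {v. absv v \<le> r}"
  proof -
    have "{v::'k. absv v \<le> r} \<in> sets borel"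
      by (simp add: absv_ball_eq_cball)
    then show ?thesis
      using modulus p unfolding absv_is_modulus_def by blast
  qed
  finally show ?thesis .
qed

lemma emeasure_mu_translate:
  assumes "E \<in> sets borel"
  shows "emeasure \<mu> ((\<lambda>x. a + x) -` E) = emeasure \<mu> E"
proof -
  have "(\<lambda>x. a + x) -` E = (\<lambda>x. - a + x) ` E"
    by (auto intro: image_eqI[where x = "a + x" for x])
  then show ?thesis
    using haar assms unfolding haar_measure_def by metis
qed

sublocale K: ultrametric_haar \<mu> absv \<rho> \<rho>
proof -
  interpret sigma_finite_measure \<mu>
    by (rule sigma_finite_mu)
  show "ultrametric_haar \<mu> absv \<rho> \<rho>"
  proof
    fix U :: "'k set" assume "open U" "0 \<in> U"
    then show "\<exists>r>0. {v. absv v \<le> r} \<subseteq> U"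
      unfolding absv_ball_eq_cball using open_contains_cball by blast
  next
    fix r :: real assume "0 < r"
    then have "0 < emeasure \<mu> (ball 0 r)"
      using haar unfolding haar_measure_def by auto
    also have "\<dots> \<le> emeasure \<mu> {v. absv v \<le> r}"
      unfolding absv_ball_eq_cball by (intro emeasure_mono) (auto simp: sets_mu)
    finally show "0 < emeasure \<mu> {v. absv v \<le> r}" .
  qed (use p emeasure_mu_ball_finite emeasure_mu_scale emeasure_mu_translate sets_mu in
      \<open>auto simp: absv_add_le absv_ball_eq_cball\<close>)
qed

lemma measurable_vec_lambda_mu:
  "vec_lambda \<in> (\<Pi>\<^sub>M i\<in>(UNIV :: 'm::finite set). \<mu>) \<rightarrow>\<^sub>M (borel :: ('k ^ 'm) measure)"
proof -
  have "sets (\<Pi>\<^sub>M i\<in>(UNIV :: 'm set). \<mu>) = sets (\<Pi>\<^sub>M i\<in>UNIV. borel)"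
    by (intro sets_PiM_cong refl sets_mu)
  then show ?thesis
    using measurable_vec_lambda measurable_cong_sets by blast
qed

lemma sets_borel_power: "sets (borel_power \<mu>) = sets borel"
  by (simp add: borel_power_def)

lemma emeasure_borel_power:
  fixes E :: "('k ^ 'm) set"
  assumes "E \<in> sets borel"
  shows "emeasure (borel_power \<mu>) E = emeasure (\<Pi>\<^sub>M i\<in>UNIV. \<mu>) (vec_lambda -` E)"
  using emeasure_distr[OF measurable_vec_lambda_mu assms] unfolding borel_power_def
  by (simp add: space_PiM space_mu)

lemma emeasure_borel_power_box:
  assumes X: "\<And>i. X i \<in> sets borel"
  shows "emeasure (borel_power \<mu>) {v::'k ^ 'm. \<forall>i. v $ i \<in> X i} = (\<Prod>i\<in>UNIV. emeasure \<mu> (X i))"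
proof -
  interpret product_sigma_finite "\<lambda>_::'m. \<mu>"
    by (simp add: product_sigma_finite_def sigma_finite_mu)
  have "{v\<in>space borel. \<forall>i. v $ i \<in> X i} \<in> sets (borel :: ('k ^ 'm) measure)"
    using X by measurable
  then have "emeasure (borel_power \<mu>) {v::'k ^ 'm. \<forall>i. v $ i \<in> X i} =
      emeasure (\<Pi>\<^sub>M i\<in>UNIV. \<mu>) (vec_lambda -` {v::'k ^ 'm. \<forall>i. v $ i \<in> X i})"
    by (intro emeasure_borel_power) simp
  also have "vec_lambda -` {v::'k ^ 'm. \<forall>i. v $ i \<in> X i} = (\<Pi>\<^sub>E i\<in>UNIV. X i)"
    by (auto simp: PiE_def Pi_def)
  also have "emeasure (\<Pi>\<^sub>M i\<in>UNIV. \<mu>) \<dots> = (\<Prod>i\<in>UNIV. emeasure \<mu> (X i))"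
    using X by (intro emeasure_PiM) (auto simp: sets_mu)
  finally show ?thesis .
qed

text \<open>The image of the product measure under a coordinatewise translation has the same values
  on boxes, which determine it.\<close>

lemma emeasure_borel_power_translate:
  fixes E :: "('k ^ 'm) set"
  assumes E: "E \<in> sets borel"
  shows "emeasure (borel_power \<mu>) ((\<lambda>x. a + x) -` E) = emeasure (borel_power \<mu>) E"
proof -
  interpret product_sigma_finite "\<lambda>_::'m. \<mu>"
    by (simp add: product_sigma_finite_def sigma_finite_mu)
  define P where "P = (\<Pi>\<^sub>M i\<in>(UNIV::'m set). \<mu>)"
  define h where "h x = (\<lambda>i. a $ i + x i)" for x
  have h: "h \<in> P \<rightarrow>\<^sub>M P"
    unfolding P_def h_def
  proof (rule measurable_PiM_single')
    fix i :: 'm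
    have "(\<lambda>t. a $ i + t) \<in> \<mu> \<rightarrow>\<^sub>M \<mu>"
      unfolding measurable_cong_sets[OF sets_mu sets_mu]
      by (intro borel_measurable_continuous_onI continuous_intros)
    then show "(\<lambda>x. a $ i + x i) \<in> (\<Pi>\<^sub>M i\<in>UNIV. \<mu>) \<rightarrow>\<^sub>M \<mu>"
      by (rule measurable_compose[OF measurable_component_singleton, rotated]) simp
  qed (auto simp: space_mu)
  have "distr P P h = P"
    unfolding P_def
  proof (rule PiM_eqI)
    fix A :: "'m \<Rightarrow> 'k set" assume A: "\<And>i. i \<in> UNIV \<Longrightarrow> A i \<in> sets \<mu>"
    have "emeasure (distr P P h) (Pi\<^sub>E UNIV A) = emeasure P (h -` Pi\<^sub>E UNIV A \<inter> space P)"
      using A by (intro emeasure_distr h) (auto simp: P_def)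
    also have "h -` Pi\<^sub>E UNIV A \<inter> space P = (\<Pi>\<^sub>E i\<in>UNIV. (\<lambda>t. a $ i + t) -` A i)"
      by (auto simp: h_def P_def space_PiM space_mu PiE_def Pi_def)
    also have "emeasure P \<dots> = (\<Prod>i\<in>UNIV. emeasure \<mu> ((\<lambda>t. a $ i + t) -` A i))"
      unfolding P_def
    proof (intro emeasure_PiM)
      fix i :: 'm
      have "(\<lambda>t. a $ i + t) \<in> \<mu> \<rightarrow>\<^sub>M \<mu>"
        unfolding measurable_cong_sets[OF sets_mu sets_mu]
        by (intro borel_measurable_continuous_onI continuous_intros)
      then show "(\<lambda>t. a $ i + t) -` A i \<in> sets \<mu>"
        using A measurable_sets[of "\<lambda>t. a $ i + t" \<mu> \<mu> "A i"] by (simp add: space_mu)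
    qed simp
    also have "\<dots> = (\<Prod>i\<in>UNIV. emeasure \<mu> (A i))"
      using A by (intro prod.cong refl emeasure_mu_translate) (auto simp: sets_mu)
    finally show "emeasure (distr (\<Pi>\<^sub>M i\<in>UNIV. \<mu>) (\<Pi>\<^sub>M i\<in>UNIV. \<mu>) h) (Pi\<^sub>E UNIV A) =
        (\<Prod>i\<in>UNIV. emeasure \<mu> (A i))"
      by (simp add: P_def)
  qed auto
  have E': "(\<lambda>x. a + x) -` E \<in> sets borel"
    using measurable_sets[of "\<lambda>x. a + x" borel borel E] E
    by (auto intro!: borel_measurable_continuous_onI continuous_intros)
  have vE: "vec_lambda -` E \<in> sets P"
    using measurable_sets[OF measurable_vec_lambda_mu E] by (simp add: P_def space_PiM space_mu)
  have "emeasure (borel_power \<mu>) ((\<lambda>x. a + x) -` E) = emeasure P (vec_lambda -` (\<lambda>x. a + x) -` E)"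
    using E' by (simp add: emeasure_borel_power P_def)
  also have "vec_lambda -` (\<lambda>x. a + x) -` E = h -` (vec_lambda -` E) \<inter> space P"
  proof -
    have "vec_lambda (h x) = a + vec_lambda x" for x
      by (simp add: h_def vec_eq_iff)
    then show ?thesis
      by (auto simp: P_def space_PiM space_mu)
  qed
  also have "emeasure P \<dots> = emeasure (distr P P h) (vec_lambda -` E)"
    using h vE by (simp add: emeasure_distr)
  also have "\<dots> = emeasure (borel_power \<mu>) E"
    using E \<open>distr P P h = P\<close> by (simp add: emeasure_borel_power P_def)
  finally show ?thesis .
qed

lemma emeasure_borel_power_ball:
  "emeasure (borel_power \<mu>) {v::'k ^ 'm. max_norm v \<le> r} = emeasure \<mu> {t. absv t \<le> r} ^ CARD('m)"
proof -
  have "{t::'k. absv t \<le> r} \<in> sets borel"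
    by (simp add: absv_ball_eq_cball)
  then show ?thesis
    using emeasure_borel_power_box[of "\<lambda>_::'m. {t. absv t \<le> r}"] by (simp add: max_norm_le_iff)
qed

text \<open>Balls of the maximum norm are cubes, so the factor \<open>\<rho>\<close> of the field
  appears once for each coordinate.\<close>

lemma ultrametric_haar_borel_power:
  "ultrametric_haar (borel_power \<mu> :: ('k ^ 'm) measure) max_norm \<rho> (\<rho> ^ CARD('m))"
proof -
  have ball: "{v::'k ^ 'm. max_norm v \<le> r} \<in> sets borel" for r
    using closed_max_norm_cball[of 0 r] by (simp add: borel_closed)
  have fin: "emeasure (borel_power \<mu>) {v::'k ^ 'm. max_norm v \<le> r} < \<infinity>" for r
    using emeasure_mu_ball_finite[of r] by (simp add: emeasure_borel_power_ball power_less_top_ennreal)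
  interpret sigma_finite_measure "borel_power \<mu> :: ('k ^ 'm) measure"
  proof (rule sigma_finite_measureI_incseq)
    show "{v. max_norm v \<le> real n} \<in> sets (borel_power \<mu> :: ('k ^ 'm) measure)" for n
      by (simp add: sets_borel_power ball)
    show "(\<Union>n. {v::'k ^ 'm. max_norm v \<le> real n}) = space (borel_power \<mu>)"
      using real_arch_simple by (auto simp: borel_power_def)
    show "emeasure (borel_power \<mu>) {v::'k ^ 'm. max_norm v \<le> real n} \<noteq> \<infinity>" for n
      using fin[of "real n"] by auto
  qed
  show ?thesis
  proof
    fix U :: "('k ^ 'm) set" assume "open U" "0 \<in> U"
    then show "\<exists>r>0. {v. max_norm v \<le> r} \<subseteq> U"
      using open_contains_max_norm_cball[of U 0] by simp
  next
    fix r :: real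
    show "emeasure (borel_power \<mu>) {v::'k ^ 'm. max_norm v \<le> \<rho> * r} =
        ennreal (\<rho> ^ CARD('m)) * emeasure (borel_power \<mu>) {v::'k ^ 'm. max_norm v \<le> r}"
      by (simp add: emeasure_borel_power_ball emeasure_mu_scale power_mult_distrib ennreal_power)
    assume "0 < r"
    then show "0 < emeasure (borel_power \<mu>) {v::'k ^ 'm. max_norm v \<le> r}"
      using K.emeasure_ball_pos[of r]
      by (simp add: emeasure_borel_power_ball zero_less_power zero_less_iff_neq_zero)
  next
    show "\<rho> ^ CARD('m) < 1"
      using p power_Suc_less_one[of \<rho> "CARD('m) - 1"] by simp
  qed (use p fin ball emeasure_borel_power_translate sets_borel_power in \<open>auto intro: max_norm_add_le\<close>)
qed

end

subsection \<open>Approximate partial derivatives\<close>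

locale haar_field_fun = haar_field \<mu> p
  for \<mu> :: "'k::nonarch_local_field measure" and p :: 'k +
  fixes f :: "'k ^ 'm \<Rightarrow> 'k ^ 'n"
begin

sublocale V: ultrametric_haar "borel_power \<mu> :: ('k ^ 'm) measure" max_norm \<rho> "\<rho> ^ CARD('m)"
  by (rule ultrametric_haar_borel_power)

text \<open>Written without division, the condition is visibly Borel in the pair
  \<open>(x, t)\<close> and false at \<open>t = 0\<close>.\<close>

definition bad :: "'m \<Rightarrow> 'k ^ 'n \<Rightarrow> nat \<Rightarrow> 'k ^ 'm \<Rightarrow> 'k set" where
  "bad i d k x = {t. \<rho> ^ k * absv t < max_norm (f (x + t *s axis i 1) - f x - t *s d)}"

lemma rho_pos: "0 < \<rho> ^ k"
  using p by simp

lemma ex_rho_power_less: "e > 0 \<Longrightarrow> \<exists>k. \<rho> ^ k < e"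
  using p real_arch_pow_inv by blast

lemma max_norm_le_all_eq_0:
  fixes w :: "'k ^ 'a"
  assumes "\<And>k. max_norm w \<le> \<rho> ^ k"
  shows "w = 0"
proof -
  have "\<not> 0 < max_norm w"
    using ex_rho_power_less[of "max_norm w"] assms by (auto simp: not_le[symmetric])
  then show ?thesis
    using max_norm_nonneg[of w] by (simp add: less_le)
qed

lemma max_norm_diff_quot:
  fixes y :: "'k ^ 'n"
  assumes "t \<noteq> 0"
  shows "max_norm (diff_quot f x v t - y) = max_norm (f (x + t *s v) - f x - t *s y) / absv t"
proof -
  have eq: "diff_quot f x v t - y = (1 / t) *s (f (x + t *s v) - f x - t *s y)"
    using assms by (simp add: diff_quot_def vector_sub_rdistrib vector_smult_assoc vector_ssub_ldistrib)
  show ?thesis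
    unfolding eq max_norm_scale by (simp add: absv_divide)
qed

lemma zero_not_bad: "0 \<notin> bad i d k x"
  by (simp add: bad_def)

lemma bad_iff: "t \<in> bad i d k x \<longleftrightarrow> t \<noteq> 0 \<and> \<rho> ^ k < max_norm (diff_quot f x (axis i 1) t - d)"
proof (cases "t = 0")
  case False
  then show ?thesis
    by (simp add: max_norm_diff_quot bad_def pos_less_divide_eq)
qed (simp add: zero_not_bad)

lemma has_ap_partial_iff: "has_ap_partial \<mu> i f x y \<longleftrightarrow> (\<forall>k. K.null_density (bad i y k x))"
proof -
  have "has_ap_partial \<mu> i f x y \<longleftrightarrow>
      (\<forall>W. open W \<and> y \<in> W \<longrightarrow> K.null_density (- (diff_quot f x (axis i 1) -` W)))"
    by (simp add: has_ap_partial_def has_ap_lim_def K.density_zero_iff)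
  also have "\<dots> \<longleftrightarrow> (\<forall>k. K.null_density (bad i y k x))"
  proof safe
    fix k
    assume *: "\<forall>W. open W \<and> y \<in> W \<longrightarrow> K.null_density (- (diff_quot f x (axis i 1) -` W))"
    define W where "W = {w. max_norm (w - y) \<le> \<rho> ^ k}"
    have "open W" "y \<in> W"
      unfolding W_def using rho_pos[of k] open_max_norm_cball[of "\<rho> ^ k" y] by auto
    then have "K.null_density (- (diff_quot f x (axis i 1) -` W))"
      using * by blast
    then show "K.null_density (bad i y k x)"
      by (rule K.null_density_mono) (auto simp: bad_iff W_def)
  next
    fix W assume *: "\<forall>k. K.null_density (bad i y k x)" "open W" "y \<in> W"
    obtain e where e: "e > 0" "{w. max_norm (w - y) \<le> e} \<subseteq> W"
      using open_contains_max_norm_cball *(2,3) by blast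
    obtain k where k: "\<rho> ^ k < e"
      using ex_rho_power_less e(1) by blast
    \<comment> \<open>At \<open>t = 0\<close> the quotient is a default value that may lie outside
      \<open>W\<close>, whereas \<open>bad\<close> omits 0; the null singleton fills this
      gap.\<close>
    have "K.null_density (bad i y k x \<union> {0})"
      using *(1) K.null_density_singleton K.null_density_Un by blast
    then show "K.null_density (- (diff_quot f x (axis i 1) -` W))"
    proof (rule K.null_density_mono)
      show "- (diff_quot f x (axis i 1) -` W) \<subseteq> bad i y k x \<union> {0}"
      proof
        fix t assume "t \<in> - (diff_quot f x (axis i 1) -` W)"
        then have "\<not> max_norm (diff_quot f x (axis i 1) t - y) \<le> e"
          using e(2) by blast
        then show "t \<in> bad i y k x \<union> {0}"
          using k by (auto simp: bad_iff)
      qed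
    qed
  qed
  finally show ?thesis .
qed

text \<open>Every point of an ultrametric ball is a centre of it. The set is therefore exactly the
  same for all \<open>d\<close> within the tolerance, so centres from a countable dense set lose
  nothing.\<close>

lemma bad_close:
  assumes "max_norm (y - d) \<le> \<rho> ^ k"
  shows "bad i d k x = bad i y k x"
proof -
  have "max_norm (w - d) \<le> \<rho> ^ k \<longleftrightarrow> max_norm (w - y) \<le> \<rho> ^ k" for w
    using max_norm_add_le[of "w - y" "\<rho> ^ k" "y - d"] max_norm_diff_le[of "w - d" "\<rho> ^ k" "y - d"] assms
    by auto
  then show ?thesis
    by (auto simp: bad_iff not_le[symmetric])
qed

text \<open>Two sets of null density together with {0} do not cover the field, so one nonzero
  \<open>t\<close> has a quotient close to both \<open>d\<close> and \<open>e\<close>; the coarser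
  tolerance prevails.\<close>

lemma bad_null_density_dist:
  assumes "K.null_density (bad i d k x)" "K.null_density (bad i e l x)" "k \<le> l"
  shows "max_norm (d - e) \<le> \<rho> ^ k"
proof -
  have "K.null_density (bad i d k x \<union> bad i e l x \<union> {0})"
    by (intro K.null_density_Un assms K.null_density_singleton)
  then have "bad i d k x \<union> bad i e l x \<union> {0} \<noteq> UNIV"
    using K.null_density_not_UNIV by metis
  then obtain t where "t \<noteq> 0" "t \<notin> bad i d k x" "t \<notin> bad i e l x"
    by blast
  then have "max_norm (diff_quot f x (axis i 1) t - d) \<le> \<rho> ^ k"
    "max_norm (diff_quot f x (axis i 1) t - e) \<le> \<rho> ^ l"
    by (auto simp: bad_iff not_less)
  moreover have "\<rho> ^ l \<le> \<rho> ^ k"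
    using assms(3) p by (intro power_decreasing) auto
  ultimately show ?thesis
    using max_norm_diff_le[of "diff_quot f x (axis i 1) t - e" "\<rho> ^ k" "diff_quot f x (axis i 1) t - d"]
    by auto
qed

lemma has_ap_partial_unique:
  assumes "has_ap_partial \<mu> i f x y" "has_ap_partial \<mu> i f x y'"
  shows "y = y'"
proof -
  have "max_norm (y - y') \<le> \<rho> ^ k" for k
    using assms bad_null_density_dist[of i y k x y' k] by (simp add: has_ap_partial_iff)
  then show ?thesis
    using max_norm_le_all_eq_0[of "y - y'"] by simp
qed

lemma ap_partial_eq: "has_ap_partial \<mu> i f x y \<Longrightarrow> ap_partial \<mu> i f x = y"
  unfolding ap_partial_def using has_ap_partial_unique by blast

lemma has_ap_partial_ap_partial: "x \<in> dom_ap_partial \<mu> i f \<Longrightarrow> has_ap_partial \<mu> i f x (ap_partial \<mu> i f x)"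
  using ap_partial_eq by (auto simp: dom_ap_partial_def)

text \<open>An exact equivalence at every scale: it expresses preimages of balls under the partial
  derivative by density conditions and is the source of its measurability.\<close>

lemma ap_partial_close_iff:
  assumes "x \<in> dom_ap_partial \<mu> i f"
  shows "max_norm (ap_partial \<mu> i f x - d) \<le> \<rho> ^ k \<longleftrightarrow> K.null_density (bad i d k x)"
proof -
  have nd: "K.null_density (bad i (ap_partial \<mu> i f x) k x)"
    using has_ap_partial_ap_partial[OF assms] by (simp add: has_ap_partial_iff)
  show ?thesis
  proof
    assume "max_norm (ap_partial \<mu> i f x - d) \<le> \<rho> ^ k"
    then show "K.null_density (bad i d k x)"
      using nd bad_close by metis
  next
    assume "K.null_density (bad i d k x)"
    then show "max_norm (ap_partial \<mu> i f x - d) \<le> \<rho> ^ k"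
      using bad_null_density_dist[OF nd] by blast
  qed
qed

lemma exists_limit_component:
  fixes a :: "nat \<Rightarrow> 'k"
  assumes a: "\<And>k l. k \<le> l \<Longrightarrow> absv (a k - a l) \<le> \<rho> ^ k"
  shows "\<exists>y. \<forall>k. absv (a k - y) \<le> \<rho> ^ k"
proof -
  have "Cauchy a"
  proof (rule metric_CauchyI)
    fix e :: real assume "e > 0"
    then obtain k where k: "\<rho> ^ k < e"
      using ex_rho_power_less by blast
    have "dist (a m) (a n) < e" if "m \<ge> k" "n \<ge> k" for m n
      using absv_diff_le[of "a k - a n" "\<rho> ^ k" "a k - a m"] a[OF that(1)] a[OF that(2)] k
      by (simp add: absv_dist)
    then show "\<exists>M. \<forall>m\<ge>M. \<forall>n\<ge>M. dist (a m) (a n) < e"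
      by blast
  qed
  then obtain y where y: "a \<longlonglongrightarrow> y"
    using Cauchy_convergent convergent_def by blast
  have "absv (a k - y) \<le> \<rho> ^ k" for k
  proof -
    have "y \<in> cball (a k) (\<rho> ^ k)"
    proof (rule Lim_in_closed_set[OF closed_cball _ _ y])
      show "\<forall>\<^sub>F n in sequentially. a n \<in> cball (a k) (\<rho> ^ k)"
        using a unfolding eventually_sequentially by (intro exI[of _ k]) (auto simp: absv_dist)
    qed simp
    then show ?thesis
      by (simp add: absv_dist)
  qed
  then show ?thesis by blast
qed

lemma exists_limit_vec:
  fixes a :: "nat \<Rightarrow> 'k ^ 'a"
  assumes a: "\<And>k l. k \<le> l \<Longrightarrow> max_norm (a k - a l) \<le> \<rho> ^ k"
  shows "\<exists>y. \<forall>k. max_norm (a k - y) \<le> \<rho> ^ k"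
proof -
  have "\<exists>y. \<forall>k. absv (a k $ i - y) \<le> \<rho> ^ k" for i
    using a by (intro exists_limit_component) (simp add: max_norm_le_iff)
  then obtain y where "\<And>i k. absv (a k $ i - y i) \<le> \<rho> ^ k"
    by metis
  then show ?thesis
    by (intro exI[of _ "\<chi> i. y i"]) (simp add: max_norm_le_iff)
qed

lemma exists_dense_sequence: "\<exists>d::nat \<Rightarrow> 'k ^ 'n. \<forall>w k. \<exists>n. max_norm (w - d n) \<le> \<rho> ^ k"
proof -
  obtain D :: "('k ^ 'n) set" where D: "countable D" "\<And>X. open X \<Longrightarrow> X \<noteq> {} \<Longrightarrow> \<exists>d\<in>D. d \<in> X"
    using countable_dense_setE by metis
  have "D \<noteq> {}"
    using D(2)[of UNIV] by auto
  have "\<exists>n. max_norm (w - from_nat_into D n) \<le> \<rho> ^ k" for w k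
  proof -
    have "w \<in> {v. max_norm (v - w) \<le> \<rho> ^ k}"
      using rho_pos[of k] by simp
    then obtain d where "d \<in> D" "max_norm (d - w) \<le> \<rho> ^ k"
      using D(2)[OF open_max_norm_cball[OF rho_pos[of k], of w]] by blast
    then show ?thesis
      using from_nat_into_surj[OF D(1)] by (metis max_norm_minus_commute)
  qed
  then show ?thesis by blast
qed

definition dn :: "nat \<Rightarrow> 'k ^ 'n" where
  "dn = (SOME d. \<forall>w k. \<exists>n. max_norm (w - d n) \<le> \<rho> ^ k)"

lemma dn: "\<exists>n. max_norm (w - dn n) \<le> \<rho> ^ k"
  using someI_ex[OF exists_dense_sequence] unfolding dn_def by blast

text \<open>A countable index set for balls filling an open set \<open>W\<close>, so that preimages
  of \<open>W\<close> become countable unions of preimages of balls.\<close>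

definition balls :: "('k ^ 'n) set \<Rightarrow> (nat \<times> nat) set" where
  "balls W = {(n, k). {w. max_norm (w - dn n) \<le> \<rho> ^ k} \<subseteq> W}"

lemma mem_open_iff_balls:
  assumes "open W"
  shows "w \<in> W \<longleftrightarrow> (\<exists>(n, k)\<in>balls W. max_norm (w - dn n) \<le> \<rho> ^ k)"
proof safe
  assume "w \<in> W"
  then obtain e where e: "e > 0" "{v. max_norm (v - w) \<le> e} \<subseteq> W"
    using open_contains_max_norm_cball assms by blast
  obtain k where k: "\<rho> ^ k < e"
    using ex_rho_power_less e(1) by blast
  obtain n where n: "max_norm (w - dn n) \<le> \<rho> ^ k"
    using dn by blast
  have "max_norm (v - w) \<le> e" if "max_norm (v - dn n) \<le> \<rho> ^ k" for v
    using max_norm_diff_le[OF that n] k by simp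
  then have "(n, k) \<in> balls W"
    using e(2) by (auto simp: balls_def)
  then show "\<exists>(n, k)\<in>balls W. max_norm (w - dn n) \<le> \<rho> ^ k"
    using n by blast
qed (auto simp: balls_def)

text \<open>Conversely, the centres chosen at the various scales are mutually close by
  \<open>bad_null_density_dist\<close> and converge by completeness. The limit stays within
  \<open>\<rho> ^ k\<close> of the centre for \<open>k\<close>, so \<open>bad_close\<close> replaces
  that centre by the limit.\<close>

lemma dom_ap_partial_iff:
  "x \<in> dom_ap_partial \<mu> i f \<longleftrightarrow> (\<forall>k. \<exists>n. K.null_density (bad i (dn n) k x))"
proof safe
  fix k assume "x \<in> dom_ap_partial \<mu> i f"
  then show "\<exists>n. K.null_density (bad i (dn n) k x)"
    using dn ap_partial_close_iff by metis
next
  assume "\<forall>k. \<exists>n. K.null_density (bad i (dn n) k x)"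
  then obtain n where n: "\<And>k. K.null_density (bad i (dn (n k)) k x)"
    by metis
  obtain y where "\<And>k. max_norm (dn (n k) - y) \<le> \<rho> ^ k"
    using exists_limit_vec[of "\<lambda>k. dn (n k)"] bad_null_density_dist[OF n n] by blast
  then have "K.null_density (bad i y k x)" for k
    using n bad_close[of "dn (n k)" y k] by simp
  then show "x \<in> dom_ap_partial \<mu> i f"
    using has_ap_partial_iff by (auto simp: dom_ap_partial_def)
qed

section \<open>The approximate total derivative and its uniqueness\<close>

lemma has_ap_derivative_iff:
  "has_ap_derivative \<mu> f x T \<longleftrightarrow> Vector_Spaces.linear (*s) (*s) T \<and>
     (\<forall>k. V.null_density {v. \<rho> ^ k * max_norm v < max_norm (f (x + v) - f x - T v)})"
proof -
  define h where "h v = max_norm (f (x + v) - f x - T v) / max_norm v" for v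
  have h: "0 \<le> h v" for v
    by (simp add: h_def)
  have h_iff: "\<rho> ^ k < h v \<longleftrightarrow> v \<noteq> 0 \<and> \<rho> ^ k * max_norm v < max_norm (f (x + v) - f x - T v)" for k v
  proof (cases "v = 0")
    case False
    then have "max_norm v > 0"
      using max_norm_nonneg[of v] by (simp add: less_le)
    then show ?thesis
      using False by (simp add: h_def pos_less_divide_eq)
  qed (use rho_pos[of k] in \<open>simp add: h_def\<close>)
  have "has_ap_lim (haar_power \<mu>) max_norm
       (\<lambda>z. max_norm (f z - f x - T (z - x)) / max_norm (z - x)) x 0 \<longleftrightarrow>
     (\<forall>W. open W \<and> 0 \<in> W \<longrightarrow> V.null_density (- (h -` W)))"
    by (simp add: has_ap_lim_def haar_power_def V.density_zero_completion_iff vimage_def h_def Compl_eq)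
  also have "\<dots> \<longleftrightarrow> (\<forall>k. V.null_density {v. \<rho> ^ k < h v})"
  proof safe
    fix k assume *: "\<forall>W. open W \<and> 0 \<in> W \<longrightarrow> V.null_density (- (h -` W))"
    have "V.null_density (- (h -` {..<\<rho> ^ k}))"
      using *[rule_format, of "{..<\<rho> ^ k}"] rho_pos[of k] by simp
    then show "V.null_density {v. \<rho> ^ k < h v}"
      by (rule V.null_density_mono) auto
  next
    fix W :: "real set" assume *: "\<forall>k. V.null_density {v. \<rho> ^ k < h v}" "open W" "0 \<in> W"
    obtain e where e: "e > 0" "ball 0 e \<subseteq> W"
      using *(2,3) open_contains_ball by blast
    obtain k where k: "\<rho> ^ k < e"
      using ex_rho_power_less e(1) by blast
    have "- (h -` W) \<subseteq> {v. \<rho> ^ k < h v}"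
    proof
      fix v assume "v \<in> - (h -` W)"
      then have "h v \<notin> ball 0 e"
        using e(2) by blast
      then show "v \<in> {v. \<rho> ^ k < h v}"
        using h[of v] k by (simp add: dist_real_def)
    qed
    then show "V.null_density (- (h -` W))"
      using *(1) V.null_density_mono by blast
  qed
  also have "\<dots> \<longleftrightarrow> (\<forall>k. V.null_density {v. \<rho> ^ k * max_norm v < max_norm (f (x + v) - f x - T v)})"
  proof (intro all_cong1 iffI)
    fix k assume "V.null_density {v. \<rho> ^ k < h v}"
    then have "V.null_density ({v. \<rho> ^ k < h v} \<union> {0})"
      by (intro V.null_density_Un V.null_density_singleton)
    then show "V.null_density {v. \<rho> ^ k * max_norm v < max_norm (f (x + v) - f x - T v)}"
      by (rule V.null_density_mono) (auto simp: h_iff)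
  next
    fix k assume "V.null_density {v. \<rho> ^ k * max_norm v < max_norm (f (x + v) - f x - T v)}"
    then show "V.null_density {v. \<rho> ^ k < h v}"
      by (rule V.null_density_mono) (auto simp: h_iff)
  qed
  finally show ?thesis
    by (simp add: has_ap_derivative_def)
qed

text \<open>The coordinate axes may be null and cannot be tested directly. Instead
  \<open>w j\<close>, on an axis, is written as the difference of \<open>w j + v\<close> and
  \<open>v\<close>, both outside the exceptional set. There \<open>T\<close> and \<open>T'\<close>
  nearly agree, and linearity transfers this to \<open>w j\<close>.\<close>

lemma has_ap_derivative_unique:
  assumes T: "has_ap_derivative \<mu> f x T" and T': "has_ap_derivative \<mu> f x T'"
  shows "T = T'"
proof -
  interpret T: Vector_Spaces.linear "(*s)" "(*s)" T
    using T by (simp add: has_ap_derivative_def)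
  interpret T': Vector_Spaces.linear "(*s)" "(*s)" T'
    using T' by (simp add: has_ap_derivative_def)
  have "max_norm (T (axis i 1) - T' (axis i 1)) \<le> \<rho> ^ k" for i k
  proof -
    define F where "F = {v. \<rho> ^ k * max_norm v < max_norm (f (x + v) - f x - T v)} \<union>
      {v. \<rho> ^ k * max_norm v < max_norm (f (x + v) - f x - T' v)}"
    define w where "w j = p ^ j *s (axis i 1 :: 'k ^ 'm)" for j
    have w: "w j \<in> V.B j" for j
      by (simp add: w_def V.B_def max_norm_scale absv_power)
    have F: "V.vanishing (\<lambda>j. F \<inter> V.B j)"
      using T T' V.null_density_Un unfolding F_def has_ap_derivative_iff V.null_density_def[symmetric] by blast
    \<comment> \<open>Both the exceptional set and its translate by \<open>w j\<close> are
      vanishing, so their union does not exhaust every ball.\<close>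
    obtain j v where v: "v \<in> V.B j" "v \<notin> F \<inter> V.B j" "w j + v \<notin> F \<inter> V.B j"
      using V.vanishing_not_B[OF V.vanishing_Un[OF F V.vanishing_translate[OF F, of w]]] by auto
    have small: "max_norm (T u - T' u) \<le> \<rho> ^ k * \<rho> ^ j" if "u \<in> V.B j" "u \<notin> F" for u
    proof -
      have "\<rho> ^ k * max_norm u \<le> \<rho> ^ k * \<rho> ^ j"
        using that(1) rho_pos[of k] by (simp add: V.B_def)
      then show ?thesis
        using that(2) max_norm_diff_le[of "f (x + u) - f x - T' u" "\<rho> ^ k * \<rho> ^ j" "f (x + u) - f x - T u"]
        by (auto simp: F_def not_less)
    qed
    have eq: "T (w j) - T' (w j) = p ^ j *s (T (axis i 1) - T' (axis i 1))"
      by (simp add: w_def T.scale T'.scale vector_ssub_ldistrib)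
    have "T (w j) - T' (w j) = (T (w j + v) - T' (w j + v)) - (T v - T' v)"
      by (simp add: T.add T'.add)
    then have "max_norm (T (w j) - T' (w j)) \<le> \<rho> ^ k * \<rho> ^ j"
      using max_norm_diff_le[OF small[of "w j + v"] small[of v]] v w[of j] V.B_add[of "w j" j v] by simp
    then have "\<rho> ^ j * max_norm (T (axis i 1) - T' (axis i 1)) \<le> \<rho> ^ j * \<rho> ^ k"
      unfolding eq max_norm_scale by (simp add: absv_power mult.commute)
    then show ?thesis
      using rho_pos[of j] by simp
  qed
  then have axis: "T (axis i 1) = T' (axis i 1)" for i
    using max_norm_le_all_eq_0[of "T (axis i 1) - T' (axis i 1)"] by simp
  show "T = T'"
  proof
    fix v
    have "T v = T (\<Sum>i\<in>UNIV. v $ i *s axis i 1)" "T' v = T' (\<Sum>i\<in>UNIV. v $ i *s axis i 1)"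
      by (simp_all add: basis_expansion)
    then show "T v = T' v"
      by (simp add: T.sum T'.sum T.scale T'.scale axis)
  qed
qed

section \<open>Coordinate slices\<close>

definition slice :: "'m set \<Rightarrow> 'k ^ 'm \<Rightarrow> 'k ^ 'm" where
  "slice I v = (\<chi> i. if i \<in> I then v $ i else 0)"

lemma slice_add: "slice I (v + w) = slice I v + slice I w"
  by (simp add: slice_def vec_eq_iff)

lemma max_norm_slice: "max_norm (slice I v) \<le> max_norm v"
  by (simp add: slice_def max_norm_le_iff absv_nth_le_max_norm)

lemma slice_measurable [measurable]: "slice I \<in> borel \<rightarrow>\<^sub>M borel"
  unfolding slice_def by measurable

lemma slice_insert: "i \<notin> I \<Longrightarrow> slice (insert i I) v = slice I v + v $ i *s axis i 1"
  by (auto simp: slice_def vec_eq_iff axis_def)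

lemma slice_add_axis: "i \<notin> I \<Longrightarrow> slice I (s *s axis i 1 + v) = slice I v"
  by (auto simp: slice_def vec_eq_iff axis_def)

lemma slice_UNIV [simp]: "slice UNIV v = v"
  by (simp add: slice_def)

lemma slice_empty [simp]: "slice {} v = 0"
  by (simp add: slice_def vec_eq_iff)

text \<open>The coordinate \<open>v $ i\<close> is independent of \<open>slice I v\<close>; the translations along
  \<open>axis i 1\<close> preserve both \<open>V.B j\<close> and the measure, so Fubini's theorem applies without splitting
  the vector space into a product.\<close>

lemma emeasure_slice_le:
  assumes i: "i \<notin> I" and Q [measurable]: "Q \<in> sets (borel \<Otimes>\<^sub>M borel)"
    and le: "\<And>v. v \<in> V.B j \<Longrightarrow> emeasure \<mu> {s\<in>K.B j. (slice I v, s) \<in> Q} \<le> e * emeasure \<mu> (K.B j)"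
  shows "emeasure (borel_power \<mu>) {v\<in>V.B j. (slice I v, v $ i) \<in> Q} \<le> e * emeasure (borel_power \<mu>) (V.B j)"
proof -
  define M where "M = (borel_power \<mu> :: ('k ^ 'm) measure)"
  interpret MK: pair_sigma_finite M \<mu>
    unfolding M_def by intro_locales
  have [measurable_cong]: "sets M = sets borel" "sets \<mu> = sets borel"
    by (simp_all add: M_def sets_borel_power sets_mu)
  define S where "S = {v\<in>V.B j. (slice I v, v $ i) \<in> Q}"
  have S_borel [measurable]: "S \<in> sets borel"
    unfolding S_def by measurable
  define h where "h v s = (indicator (V.B j) v * indicator (K.B j) s * indicator Q (slice I v, s + v $ i) :: ennreal)" for v s
  have h [measurable]: "case_prod h \<in> borel_measurable (M \<Otimes>\<^sub>M \<mu>)"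
    unfolding h_def by measurable
  have mem: "s *s axis i 1 + v \<in> S \<longleftrightarrow> v \<in> V.B j \<and> (slice I v, s + v $ i) \<in> Q" if "s \<in> K.B j" for s v
  proof -
    have "s *s axis i 1 \<in> V.B j"
      using that by (simp add: V.B_def K.B_def max_norm_scale)
    then show ?thesis
      using i by (simp add: S_def V.B_add_iff slice_add_axis)
  qed
  have "emeasure \<mu> (K.B j) * emeasure M S = (\<integral>\<^sup>+s. emeasure M S * indicator (K.B j) s \<partial>\<mu>)"
    by (simp add: nn_integral_cmult_indicator mult.commute)
  also have "\<dots> = (\<integral>\<^sup>+s. \<integral>\<^sup>+v. h v s \<partial>M \<partial>\<mu>)"
  proof (intro nn_integral_cong)
    fix s
    have "emeasure M S * indicator (K.B j) s = indicator (K.B j) s * (\<integral>\<^sup>+v. indicator S (s *s axis i 1 + v) \<partial>M)"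
      unfolding M_def by (subst V.nn_integral_translate) (auto simp: sets_borel_power mult.commute)
    also have "\<dots> = (\<integral>\<^sup>+v. indicator (K.B j) s * indicator S (s *s axis i 1 + v) \<partial>M)"
      by (subst nn_integral_cmult) auto
    also have "\<dots> = (\<integral>\<^sup>+v. h v s \<partial>M)"
      by (intro nn_integral_cong) (auto simp: h_def indicator_def mem)
    finally show "emeasure M S * indicator (K.B j) s = (\<integral>\<^sup>+v. h v s \<partial>M)" .
  qed
  also have "\<dots> = (\<integral>\<^sup>+v. \<integral>\<^sup>+s. h v s \<partial>\<mu> \<partial>M)"
    by (rule MK.Fubini'[OF h])
  also have "\<dots> \<le> (\<integral>\<^sup>+v. (e * emeasure \<mu> (K.B j)) * indicator (V.B j) v \<partial>M)"
  proof (intro nn_integral_mono)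
    fix v
    show "(\<integral>\<^sup>+s. h v s \<partial>\<mu>) \<le> (e * emeasure \<mu> (K.B j)) * indicator (V.B j) v"
    proof (cases "v \<in> V.B j")
      case True
      then have "v $ i \<in> K.B j"
        using absv_nth_le_max_norm[of v i] by (simp add: V.B_def K.B_def)
      then have "s + v $ i \<in> K.B j \<longleftrightarrow> s \<in> K.B j" for s
        using K.B_add_iff[of "v $ i" j s] by (simp add: add.commute)
      then have "(\<integral>\<^sup>+s. h v s \<partial>\<mu>) = (\<integral>\<^sup>+s. indicator {s\<in>K.B j. (slice I v, s) \<in> Q} (v $ i + s) \<partial>\<mu>)"
        using True by (intro nn_integral_cong) (auto simp: h_def indicator_def add.commute)
      also have "\<dots> = emeasure \<mu> {s\<in>K.B j. (slice I v, s) \<in> Q}"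
        by (subst K.nn_integral_translate) auto
      finally show ?thesis
        using le True by simp
    qed (simp add: h_def)
  qed
  also have "\<dots> = emeasure \<mu> (K.B j) * (e * emeasure M (V.B j))"
    by (subst nn_integral_cmult_indicator) (auto simp: mult_ac)
  finally have "emeasure M S \<le> e * emeasure M (V.B j)"
    using K.emeasure_B_pos[of j] K.emeasure_B_finite[of j] by (simp add: ennreal_mult_le_mult_iff)
  then show ?thesis
    by (simp add: M_def S_def)
qed

end

subsection \<open>Borel functions\<close>

locale haar_field_borel = haar_field_fun \<mu> p f
  for \<mu> :: "'k::nonarch_local_field measure" and p :: 'k and f :: "'k ^ 'm \<Rightarrow> 'k ^ 'n" +
  assumes f_borel [measurable]: "f \<in> borel \<rightarrow>\<^sub>M borel"
begin

text \<open>Null density means that for every tolerance index \<open>l\<close> there is a threshold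
  \<open>J\<close>. Naming \<open>J\<close> makes the condition uniform: another point of the same
  set obeys the bound at the same scales.\<close>

definition C :: "'m \<Rightarrow> 'k ^ 'n \<Rightarrow> nat \<Rightarrow> nat \<Rightarrow> nat \<Rightarrow> ('k ^ 'm) set" where
  "C i d k l J = {x. \<forall>j\<ge>J. emeasure \<mu> (bad i d k x \<inter> K.B j) \<le> ennreal (1 / Suc l) * emeasure \<mu> (K.B j)}"

lemma bad_pair_borel [measurable]:
  "{z. snd z \<in> bad i d k (fst z)} \<in> sets (borel \<Otimes>\<^sub>M borel)"
proof -
  have "{z\<in>space (borel \<Otimes>\<^sub>M borel). \<rho> ^ k * absv (snd z) <
      max_norm (f (fst z + snd z *s axis i 1) - f (fst z) - snd z *s d)} \<in> sets (borel \<Otimes>\<^sub>M borel)"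
    by measurable
  then show ?thesis
    by (simp add: bad_def space_pair_measure)
qed

lemma bad_borel [measurable]: "bad i d k x \<in> sets borel"
proof -
  have "(\<lambda>t. (x, t)) -` {z. snd z \<in> bad i d k (fst z)} \<inter> space borel \<in> sets borel"
    by (rule measurable_sets[OF _ bad_pair_borel]) measurable
  then show ?thesis
    by (simp add: vimage_def)
qed

lemma C_borel [measurable]: "C i d k l J \<in> sets borel"
proof -
  have [measurable]: "(\<lambda>x. emeasure \<mu> (bad i d k x \<inter> K.B j)) \<in> borel_measurable borel" for j
  proof (rule K.measurable_emeasure)
    have "{z\<in>space (borel \<Otimes>\<^sub>M borel). z \<in> {z. snd z \<in> bad i d k (fst z)} \<and> snd z \<in> K.B j} \<in> sets (borel \<Otimes>\<^sub>M borel)"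
      by measurable
    then show "{x \<in> space (borel \<Otimes>\<^sub>M \<mu>). snd x \<in> bad i d k (fst x) \<inter> K.B j} \<in> sets (borel \<Otimes>\<^sub>M \<mu>)"
      unfolding sets_pair_measure_cong[OF refl sets_mu] by (simp add: space_pair_measure space_mu)
  qed simp
  have "{x\<in>space borel. \<forall>j\<in>{J..}. emeasure \<mu> (bad i d k x \<inter> K.B j) \<le> ennreal (1 / Suc l) * emeasure \<mu> (K.B j)} \<in> sets borel"
    by measurable
  then show ?thesis
    by (simp add: C_def Ball_def)
qed

lemma null_density_bad_iff: "K.null_density (bad i d k x) \<longleftrightarrow> (\<forall>l. \<exists>J. x \<in> C i d k l J)"
proof -
  have "bad i d k x \<inter> K.B j \<in> sets \<mu>" for j
    by (simp add: sets_mu)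
  then show ?thesis
    unfolding K.null_density_def K.vanishing_iff_nat C_def eventually_sequentially by simp
qed

lemma null_density_bad_borel [measurable]: "{x. K.null_density (bad i d k x)} \<in> sets borel"
proof -
  have "{x\<in>space borel. \<forall>l. \<exists>J. x \<in> C i d k l J} \<in> sets borel"
    by measurable
  then show ?thesis
    by (simp add: null_density_bad_iff)
qed

lemma dom_ap_partial_borel [measurable]: "dom_ap_partial \<mu> i f \<in> sets borel"
proof -
  have "dom_ap_partial \<mu> i f = {x\<in>space borel. \<forall>k. \<exists>n. x \<in> {x. K.null_density (bad i (dn n) k x)}}"
    using dom_ap_partial_iff by auto
  also have "\<dots> \<in> sets borel"
    by measurable
  finally show ?thesis .
qed

lemma ap_partial_vimage_borel:
  assumes W: "open W"
  shows "{x \<in> dom_ap_partial \<mu> i f. ap_partial \<mu> i f x \<in> W} \<in> sets borel"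
proof -
  have "{x \<in> dom_ap_partial \<mu> i f. ap_partial \<mu> i f x \<in> W} =
      (\<Union>(n, k)\<in>balls W. dom_ap_partial \<mu> i f \<inter> {x. K.null_density (bad i (dn n) k x)})"
    unfolding mem_open_iff_balls[OF W] using ap_partial_close_iff by fast
  also have "\<dots> \<in> sets borel"
    by (intro sets.countable_UN' countableI_type) (auto intro: countable_subset)
  finally show ?thesis .
qed

text \<open>Membership of the quotient in a ball is rephrased through \<open>bad\<close>, which
  contains no division by \<open>t\<close>.\<close>

lemma diff_quot_vimage_borel:
  assumes W: "open W"
  shows "{z. snd z \<noteq> 0 \<and> diff_quot f (fst z) (axis i 1) (snd z) \<in> W} \<in> sets (borel \<Otimes>\<^sub>M borel)"
proof -
  define R where "R q = {z\<in>space (borel \<Otimes>\<^sub>M borel). snd z \<noteq> 0 \<and> z \<notin> {z. snd z \<in> bad i (dn (fst q)) (snd q) (fst z)}}" for q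
  have "R q \<in> sets (borel \<Otimes>\<^sub>M borel)" for q
    unfolding R_def by measurable
  then have "(\<Union>q\<in>balls W. R q) \<in> sets (borel \<Otimes>\<^sub>M borel)"
    by (intro sets.countable_UN') auto
  also have "(\<Union>q\<in>balls W. R q) = {z. snd z \<noteq> 0 \<and> diff_quot f (fst z) (axis i 1) (snd z) \<in> W}"
    unfolding mem_open_iff_balls[OF W] R_def by (auto simp: bad_iff not_less space_pair_measure)
  finally show ?thesis .
qed

section \<open>Differentiability at generic points\<close>

definition L :: "'k ^ 'm \<Rightarrow> 'k ^ 'm \<Rightarrow> 'k ^ 'n" where
  "L x v = (\<Sum>i\<in>UNIV. v $ i *s ap_partial \<mu> i f x)"

lemma linear_L: "Vector_Spaces.linear (*s) (*s) (L x)"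
proof -
  have "L x = (*v) (\<chi> j i. ap_partial \<mu> i f x $ j)"
    by (simp add: L_def fun_eq_iff vec_eq_iff matrix_vector_mult_def mult.commute)
  then show ?thesis
    using matrix_vector_mul_linear_gen by metis
qed

lemma L_add_axis: "L x (v + s *s axis i 1) = L x v + s *s ap_partial \<mu> i f x"
proof -
  interpret L: Vector_Spaces.linear "(*s)" "(*s)" "L x"
    by (rule linear_L)
  have "L x (axis i 1) = (\<Sum>j\<in>UNIV. if j = i then ap_partial \<mu> i f x else 0)"
    unfolding L_def by (intro sum.cong) (auto simp: axis_def)
  then show ?thesis
    by (simp add: L.add L.scale)
qed

lemma L_0: "L x 0 = 0"
  by (simp add: L_def)

text \<open>Restricting the centres to \<open>dn\<close> leaves countably many parameters, so one
  null set of exceptional points serves all of them.\<close>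

definition generic :: "'k ^ 'm \<Rightarrow> bool" where
  "generic x \<longleftrightarrow> (\<forall>i n k l J I. x \<in> C i (dn n) k l J \<longrightarrow>
     V.vanishing (\<lambda>j. {v\<in>V.B j. x + slice I v \<notin> C i (dn n) k l J}))"

lemma AE_generic: "AE x in borel_power \<mu>. generic x"
proof -
  have "AE x in borel_power \<mu>. x \<in> C i (dn n) k l J \<longrightarrow>
     V.vanishing (\<lambda>j. {v\<in>V.B j. x + slice I v \<notin> C i (dn n) k l J})" for i n k l J I
    by (intro V.AE_vanishing_complement C_borel slice_measurable slice_add max_norm_slice)
  then show ?thesis
    unfolding generic_def AE_all_countable by blast
qed

text \<open>Induction on the set of coordinates already moved. The bound refers to the radius
  \<open>\<rho> ^ j\<close> and not to the norm of the slice, which can be far smaller; this uniform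
  bound survives the addition of a coordinate unchanged.\<close>

lemma vanishing_error:
  assumes x: "generic x" and dom: "\<And>i. x \<in> dom_ap_partial \<mu> i f"
  shows "V.vanishing (\<lambda>j. {v\<in>V.B j. \<rho> ^ k * \<rho> ^ j <
    max_norm (f (x + slice I v) - f x - L x (slice I v))})"
proof (induction I rule: finite_induct[OF finite])
  case 1
  have "\<not> \<rho> ^ k * \<rho> ^ j < 0" for j
    by (simp add: not_less)
  then show ?case
    by (simp add: L_0)
next
  case (2 i I)
  let ?err = "\<lambda>I v. max_norm (f (x + slice I v) - f x - L x (slice I v))"
  obtain n where n: "max_norm (ap_partial \<mu> i f x - dn n) \<le> \<rho> ^ k"
    using dn by blast
  then have nd: "\<exists>J. x \<in> C i (dn n) k l J" for l
    using ap_partial_close_iff[OF dom] null_density_bad_iff by blast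
  \<comment> \<open>The increments whose step in direction \<open>i\<close>, started at the
    intermediate point, fails the bound for \<open>dn n\<close>. They are divided into those whose
    intermediate point leaves \<open>C\<close>, handled by \<open>generic x\<close>, and the rest,
    handled by Fubini.\<close>
  define S where "S j = {v\<in>V.B j. v $ i \<in> bad i (dn n) k (x + slice I v)}" for j
  have S: "V.vanishing S"
  proof (rule V.vanishingI_nat)
    fix l :: nat
    \<comment> \<open>\<open>Suc q\<close> is twice \<open>Suc l\<close>, so the two parts of
      \<open>S j\<close> together stay within the tolerance \<open>1 / Suc l\<close>.\<close>
    define q where "q = Suc (2 * l)"
    obtain J where J: "x \<in> C i (dn n) k q J"
      using nd by blast
    define R where "R j = {v\<in>V.B j. x + slice I v \<notin> C i (dn n) k q J}" for j
    have "V.vanishing R"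
      using x J unfolding generic_def R_def by blast
    then have "\<forall>\<^sub>F j in sequentially. outer_measure_of (borel_power \<mu>) (R j) \<le> ennreal (1 / Suc q) * emeasure (borel_power \<mu>) (V.B j)"
      unfolding V.vanishing_iff_nat by blast
    moreover have "\<forall>\<^sub>F j in sequentially. j \<ge> J"
      by (rule eventually_ge_at_top)
    ultimately show "\<forall>\<^sub>F j in sequentially. outer_measure_of (borel_power \<mu>) (S j) \<le> ennreal (1 / Suc l) * emeasure (borel_power \<mu>) (V.B j)"
    proof eventually_elim
      case (elim j)
      \<comment> \<open>Membership in \<open>C\<close> is built into \<open>Q\<close>: over an
        intermediate point outside \<open>C\<close> the fibre is empty, and over the others the
        definition of \<open>C\<close> bounds it because j \<ge> J. Thus every fibre satisfies the
        hypothesis of \<open>emeasure_slice_le\<close>.\<close>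
      define Q where "Q = {z. x + fst z \<in> C i (dn n) k q J \<and> snd z \<in> bad i (dn n) k (x + fst z)}"
      have Q [measurable]: "Q \<in> sets (borel \<Otimes>\<^sub>M borel)"
      proof -
        have "(\<lambda>z. (x + fst z, snd z)) -` {z. snd z \<in> bad i (dn n) k (fst z)} \<inter> space (borel \<Otimes>\<^sub>M borel)
            \<in> sets (borel \<Otimes>\<^sub>M borel)"
          by (rule measurable_sets[OF _ bad_pair_borel]) measurable
        moreover have "(\<lambda>z. x + fst z) -` C i (dn n) k q J \<inter> space (borel \<Otimes>\<^sub>M borel :: (('k ^ 'm) \<times> 'k) measure)
            \<in> sets (borel \<Otimes>\<^sub>M borel)"
          by (rule measurable_sets[OF _ C_borel]) measurable
        ultimately have "((\<lambda>z. (x + fst z, snd z)) -` {z. snd z \<in> bad i (dn n) k (fst z)} \<inter> space (borel \<Otimes>\<^sub>M borel))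
            \<inter> ((\<lambda>z. x + fst z) -` C i (dn n) k q J \<inter> space (borel \<Otimes>\<^sub>M borel)) \<in> sets (borel \<Otimes>\<^sub>M borel)"
          by (rule sets.Int)
        also have "((\<lambda>z. (x + fst z, snd z)) -` {z. snd z \<in> bad i (dn n) k (fst z)} \<inter> space (borel \<Otimes>\<^sub>M borel))
            \<inter> ((\<lambda>z. x + fst z) -` C i (dn n) k q J \<inter> space (borel \<Otimes>\<^sub>M borel)) = Q"
          by (auto simp: Q_def space_pair_measure)
        finally show ?thesis .
      qed
      define S' where "S' = {v\<in>V.B j. (slice I v, v $ i) \<in> Q}"
      have S'_sets: "S' \<in> sets (borel_power \<mu>)"
        unfolding S'_def sets_borel_power by measurable
      have "emeasure (borel_power \<mu>) S' \<le> ennreal (1 / Suc q) * emeasure (borel_power \<mu>) (V.B j)"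
        unfolding S'_def
      proof (rule emeasure_slice_le[OF 2(2) Q])
        fix v
        show "emeasure \<mu> {s\<in>K.B j. (slice I v, s) \<in> Q} \<le> ennreal (1 / Suc q) * emeasure \<mu> (K.B j)"
        proof (cases "x + slice I v \<in> C i (dn n) k q J")
          case True
          then have "{s\<in>K.B j. (slice I v, s) \<in> Q} = bad i (dn n) k (x + slice I v) \<inter> K.B j"
            by (auto simp: Q_def)
          then show ?thesis
            using True elim(2) by (simp add: C_def)
        qed (simp add: Q_def)
      qed
      then have S'_le: "outer_measure_of (borel_power \<mu>) S' \<le> ennreal (1 / Suc q) * emeasure (borel_power \<mu>) (V.B j)"
        using S'_sets by simp
      have "S j \<subseteq> R j \<union> S'"
        by (auto simp: S_def R_def S'_def Q_def)
      then have "outer_measure_of (borel_power \<mu>) (S j) \<le> outer_measure_of (borel_power \<mu>) (R j \<union> S')"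
        by (rule outer_measure_of_mono)
      also have "\<dots> \<le> outer_measure_of (borel_power \<mu>) (R j) + outer_measure_of (borel_power \<mu>) S'"
        by (rule outer_measure_of_Un_le) auto
      also have "\<dots> \<le> ennreal (1 / Suc q) * emeasure (borel_power \<mu>) (V.B j) +
          ennreal (1 / Suc q) * emeasure (borel_power \<mu>) (V.B j)"
        by (rule add_mono[OF elim(1) S'_le])
      also have "\<dots> = ennreal (1 / Suc l) * emeasure (borel_power \<mu>) (V.B j)"
      proof -
        have "1 / real (Suc q) + 1 / real (Suc q) = 1 / real (Suc l)"
          by (simp add: q_def divide_simps)
        then have "ennreal (1 / Suc q) + ennreal (1 / Suc q) = ennreal (1 / Suc l)"
          by (subst ennreal_plus[symmetric]) auto
        then show ?thesis
          by (simp only: distrib_right[symmetric])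
      qed
      finally show ?case .
    qed
  qed
  have "V.vanishing (\<lambda>j. {v\<in>V.B j. \<rho> ^ k * \<rho> ^ j < ?err I v} \<union> S j)"
    by (rule V.vanishing_Un[OF 2(3) S])
  then show ?case
  proof (rule V.vanishing_mono')
    fix j
    show "{v\<in>V.B j. \<rho> ^ k * \<rho> ^ j < ?err (insert i I) v} \<subseteq> {v\<in>V.B j. \<rho> ^ k * \<rho> ^ j < ?err I v} \<union> S j"
    proof (rule ccontr)
      assume "\<not> ?thesis"
      then obtain v where v: "v \<in> V.B j" "\<rho> ^ k * \<rho> ^ j < ?err (insert i I) v"
        "\<not> \<rho> ^ k * \<rho> ^ j < ?err I v" "v \<notin> S j"
        by blast
      define y where "y = x + slice I v"
      have vi: "absv (v $ i) \<le> \<rho> ^ j"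
        using v(1) absv_nth_le_max_norm[of v i] by (simp add: V.B_def)
      have "max_norm (f (y + v $ i *s axis i 1) - f y - v $ i *s dn n) \<le> \<rho> ^ k * absv (v $ i)"
        using v(1,4) by (simp add: S_def bad_def y_def not_less)
      also have "\<dots> \<le> \<rho> ^ k * \<rho> ^ j"
        using vi rho_pos[of k] by simp
      finally have 1: "max_norm (f (y + v $ i *s axis i 1) - f y - v $ i *s dn n) \<le> \<rho> ^ k * \<rho> ^ j" .
      have 3: "max_norm (v $ i *s (ap_partial \<mu> i f x - dn n)) \<le> \<rho> ^ k * \<rho> ^ j"
        unfolding max_norm_scale using mult_mono[OF vi n] by (simp add: mult.commute)
      \<comment> \<open>The three errors come from the new step with \<open>dn n\<close> as slope,
        from the earlier coordinates, and from replacing the partial derivative by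
        \<open>dn n\<close>. Each is at most \<open>\<rho> ^ k * \<rho> ^ j\<close>, hence so is the
        total.\<close>
      have eq: "f (x + slice (insert i I) v) - f x - L x (slice (insert i I) v) =
         (f (y + v $ i *s axis i 1) - f y - v $ i *s dn n)
         + (f (x + slice I v) - f x - L x (slice I v)) - v $ i *s (ap_partial \<mu> i f x - dn n)"
        using 2(2) by (simp add: slice_insert L_add_axis y_def add.assoc vector_ssub_ldistrib)
      have "?err (insert i I) v \<le> \<rho> ^ k * \<rho> ^ j"
        unfolding eq by (rule max_norm_diff_le[OF max_norm_add_le[OF 1 v(3)[unfolded not_less]] 3])
      then show False
        using v(2) by simp
    qed
  qed
qed

lemma has_ap_derivative_L:
  assumes "generic x" "\<And>i. x \<in> dom_ap_partial \<mu> i f"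
  shows "has_ap_derivative \<mu> f x (L x)"
  unfolding has_ap_derivative_iff
proof (intro conjI allI linear_L)
  fix k
  let ?E = "{v. \<rho> ^ k * max_norm v < max_norm (f (x + v) - f x - L x v)}"
  \<comment> \<open>On the shell between \<open>B (Suc j)\<close> and \<open>B j\<close> the norm of
    \<open>v\<close> exceeds only \<open>\<rho> ^ Suc j\<close>. The index \<open>Suc k\<close>
    supplies the missing factor \<open>\<rho>\<close>.\<close>
  have "V.vanishing (\<lambda>j. {v\<in>V.B j. \<rho> ^ Suc k * \<rho> ^ j < max_norm (f (x + v) - f x - L x v)})"
    using vanishing_error[OF assms, of "Suc k" UNIV] by simp
  then show "V.null_density ?E"
    unfolding V.null_density_def
  proof (rule V.vanishing_shells)
    fix j
    show "?E \<inter> (V.B j - V.B (Suc j)) \<subseteq> {v\<in>V.B j. \<rho> ^ Suc k * \<rho> ^ j < max_norm (f (x + v) - f x - L x v)}"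
    proof
      fix v assume v: "v \<in> ?E \<inter> (V.B j - V.B (Suc j))"
      then have "\<rho> ^ Suc j < max_norm v"
        by (simp add: V.B_def not_le)
      then have "\<rho> ^ k * \<rho> ^ Suc j \<le> \<rho> ^ k * max_norm v"
        using rho_pos[of k] by simp
      then show "v \<in> {v\<in>V.B j. \<rho> ^ Suc k * \<rho> ^ j < max_norm (f (x + v) - f x - L x v)}"
        using v by (auto simp: mult_ac)
    qed
  qed
qed

end

subsection \<open>Measurable functions\<close>

text \<open>The preimage of each basic open set is a set of \<open>M\<close> up to a null part. A
  countable basis allows all these null parts to be enclosed in a single null set
  \<open>N\<close>.\<close>

lemma completion_AE_eq_borel_measurable:
  fixes f :: "'a \<Rightarrow> 'b::second_countable_topology"
  assumes f: "f \<in> completion M \<rightarrow>\<^sub>M borel"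
  shows "\<exists>g N. g \<in> M \<rightarrow>\<^sub>M borel \<and> N \<in> null_sets M \<and> (\<forall>x\<in>space M - N. f x = g x)"
proof -
  obtain B :: "'b set set" where B: "countable B" "topological_basis B"
    using ex_countable_basis by blast
  define S where "S U = f -` U \<inter> space M" for U
  have S: "S U \<in> sets (completion M)" if "U \<in> B" for U
    using measurable_sets[OF f, of U] topological_basis_open[OF B(2) that] by (simp add: S_def)
  have "AE x in M. \<forall>U\<in>B. x \<notin> null_part M (S U)"
    using B(1) S by (simp add: AE_ball_countable AE_notin_null_part)
  then obtain N where N: "N \<in> null_sets M" "{x\<in>space M. \<not> (\<forall>U\<in>B. x \<notin> null_part M (S U))} \<subseteq> N"
    by (auto simp: eventually_ae_filter)
  \<comment> \<open>On \<open>N\<close> the function is made constant, so a preimage meets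
    \<open>N\<close> in all of \<open>N\<close> or not at all.\<close>
  define g where "g x = (if x \<in> N then undefined else f x)" for x
  have "g \<in> M \<rightarrow>\<^sub>M borel"
  proof (rule borel_measurableI)
    fix W :: "'b set" assume "open W"
    then obtain B' where B': "B' \<subseteq> B" "\<Union>B' = W"
      using B(2) by (auto simp: topological_basis_def)
    have "g -` U \<inter> space M \<in> sets M" if "U \<in> B'" for U
    proof -
      have U: "U \<in> B"
        using B'(1) that by blast
      have "S U = main_part M (S U) \<union> null_part M (S U)"
        using S[OF U] by simp
      then have "x \<in> S U \<longleftrightarrow> x \<in> main_part M (S U)" if "x \<in> space M" "x \<notin> N" for x
        using N(2) that U by blast
      then have "g -` U \<inter> space M = (main_part M (S U) - N) \<union> (if undefined \<in> U then N else {})"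
        using sets.sets_into_space[of N M] N(1) sets.sets_into_space[OF main_part_sets[OF S[OF U]]]
        by (auto simp: g_def S_def null_sets_def split: if_splits)
      then show ?thesis
        using N(1) main_part_sets[OF S[OF U]] by (auto simp: null_sets_def)
    qed
    moreover have "countable B'"
      using B(1) B'(1) countable_subset by blast
    ultimately have "(\<Union>U\<in>B'. g -` U \<inter> space M) \<in> sets M"
      by (intro sets.countable_UN') auto
    also have "(\<Union>U\<in>B'. g -` U \<inter> space M) = g -` W \<inter> space M"
      using B'(2) by auto
    finally show "g -` W \<inter> space M \<in> sets M" .
  qed
  then show ?thesis
    using N(1) by (intro exI[of _ g] exI[of _ N]) (auto simp: g_def)
qed

lemma sets_completion_AE_eq:
  assumes S: "S \<in> sets M" and T: "T \<subseteq> space M" and ae: "AE x in M. x \<in> T \<longleftrightarrow> x \<in> S"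
  shows "T \<in> sets (completion M)"
proof -
  have "AE x in M. \<not> (x \<in> T - S)" "AE x in M. \<not> (x \<in> S - T)"
    using ae by (eventually_elim, auto)+
  note this[THEN sets_completion_AE, unfolded pred_def]
  then have "(S - {x\<in>space M. x \<in> S - T}) \<union> {x\<in>space M. x \<in> T - S} \<in> sets (completion M)"
    using S by (intro sets.Un sets.Diff) auto
  also have "(S - {x\<in>space M. x \<in> S - T}) \<union> {x\<in>space M. x \<in> T - S} = T"
    using T sets.sets_into_space[OF S] by auto
  finally show ?thesis .
qed

text \<open>The exceptional null set may depend on \<open>W\<close>, since measurability is tested
  on one open set at a time.\<close>

lemma measurable_restrict_completionI:
  fixes h :: "'a \<Rightarrow> 'b::topological_space"
  assumes D: "D \<in> sets (completion M)"
    and S: "\<And>W. open W \<Longrightarrow> S W \<in> sets M"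
    and ae: "\<And>W. open W \<Longrightarrow> AE x in M. x \<in> D \<and> h x \<in> W \<longleftrightarrow> x \<in> S W"
  shows "h \<in> restrict_space (completion M) D \<rightarrow>\<^sub>M borel"
proof (rule borel_measurableI)
  fix W :: "'b set" assume W: "open W"
  have sub: "D \<subseteq> space M"
    using sets.sets_into_space[OF D] by simp
  have "{x\<in>D. h x \<in> W} \<in> sets (completion M)"
    using ae[OF W] sub by (intro sets_completion_AE_eq[OF S[OF W]]) auto
  moreover have "h -` W \<inter> space (restrict_space (completion M) D) = {x\<in>D. h x \<in> W}"
    using sub by (auto simp: space_restrict_space)
  ultimately show "h -` W \<inter> space (restrict_space (completion M) D) \<in> sets (restrict_space (completion M) D)"
    using D sub by (simp add: sets_restrict_space_iff inf.absorb1)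
qed

text \<open>The claim is generalized from \<open>UNIV\<close> to sets closed upwards and proved by
  adding a new minimum \<open>b\<close>: upward closure identifies \<open>{b<..}\<close> with the
  old set and \<open>{b..}\<close> with the new one.\<close>

lemma sum_telescope_greaterThan:
  fixes G :: "'m::{finite,linorder} set \<Rightarrow> 'b::ab_group_add"
  shows "(\<Sum>i\<in>UNIV. G {i..} - G {i<..}) = G UNIV - G {}"
proof -
  have "(\<forall>x\<in>A. {x<..} \<subseteq> A) \<longrightarrow> (\<Sum>i\<in>A. G {i..} - G {i<..}) = G A - G {}" for A :: "'m set"
  proof (induction A rule: finite_linorder_min_induct[OF finite])
    case (2 b A)
    show ?case
    proof
      assume up: "\<forall>x\<in>insert b A. {x<..} \<subseteq> insert b A"
      have gt: "{b<..} = A"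
        using up 2(2) by auto
      then have ge: "{b..} = insert b A"
        by force
      have "\<forall>x\<in>A. {x<..} \<subseteq> A"
        using gt by auto
      moreover have "b \<notin> A"
        using 2(2) by auto
      ultimately show "(\<Sum>i\<in>insert b A. G {i..} - G {i<..}) = G (insert b A) - G {}"
        using 2(3) by (simp add: ge gt)
    qed
  qed simp
  then show ?thesis by simp
qed

lemma has_ap_Phi_nonzero: "t \<noteq> 0 \<Longrightarrow> has_ap_Phi \<mu> f x v t y \<longleftrightarrow> y = diff_quot f x v t"
  by (simp add: has_ap_Phi_def)

lemma ap_Phi_exists_nonzero: "t \<noteq> 0 \<Longrightarrow> ap_Phi_exists \<mu> f x v t"
  by (simp add: ap_Phi_exists_def has_ap_Phi_nonzero)

lemma ap_Phi_nonzero: "t \<noteq> 0 \<Longrightarrow> ap_Phi \<mu> f x v t = diff_quot f x v t"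
  by (simp add: ap_Phi_def has_ap_Phi_nonzero)

text \<open>Each summand is the difference of the values of \<open>G\<close> before and after
  coordinate \<open>i\<close> joins the larger ones. If \<open>v $ i = 0\<close>, both values belong
  to the same point, which justifies the summand 0.\<close>

lemma diff_quot_telescope:
  fixes f :: "'k::nonarch_local_field ^ 'm::{finite,linorder} \<Rightarrow> 'k ^ 'n"
  assumes t: "t \<noteq> 0"
  defines "w \<equiv> \<lambda>A v. \<Sum>j\<in>A. v $ j *s axis j 1"
  shows "diff_quot f x v t =
    (\<Sum>i\<in>UNIV. if v $ i = 0 then 0 else v $ i *s diff_quot f (x + t *s w {i<..} v) (axis i 1) (v $ i * t))"
proof -
  define G where "G A = (1 / t) *s f (x + t *s w A v)" for A
  have "(if v $ i = 0 then 0 else v $ i *s diff_quot f (x + t *s w {i<..} v) (axis i 1) (v $ i * t)) =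
      G {i..} - G {i<..}" for i
  proof -
    have "{i..} = insert i {i<..}"
      by auto
    then have w: "w {i..} v = v $ i *s axis i 1 + w {i<..} v"
      by (simp add: w_def)
    show ?thesis
    proof (cases "v $ i = 0")
      case True
      then show ?thesis
        by (simp add: G_def w)
    next
      case False
      have eq: "x + t *s w {i<..} v + (v $ i * t) *s axis i 1 = x + t *s w {i..} v"
        by (simp add: w vector_add_ldistrib vector_smult_assoc mult.commute add.assoc add.commute[of "t *s w {i<..} v"])
      show ?thesis
        unfolding diff_quot_def eq using False t
        by (simp add: G_def vector_smult_assoc vector_ssub_ldistrib)
    qed
  qed
  moreover have "diff_quot f x v t = G UNIV - G {}"
    by (simp add: diff_quot_def G_def w_def basis_expansion vector_ssub_ldistrib)
  ultimately show ?thesis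
    by (simp add: sum_telescope_greaterThan)
qed

text \<open>A measurable function may be replaced by a Borel function \<open>g\<close> outside of a null set \<open>N\<close>; the
  approximate notions at \<open>x\<close> agree for \<open>f\<close> and \<open>g\<close> as soon as \<open>x \<notin> N\<close> and \<open>N\<close> is null on the lines
  through \<open>x\<close> in the coordinate directions.\<close>

locale haar_field_modification = haar_field_borel \<mu> p g + F: haar_field_fun \<mu> p f
  for \<mu> :: "'k::nonarch_local_field measure" and p :: 'k and f g :: "'k ^ 'm \<Rightarrow> 'k ^ 'n" +
  fixes N :: "('k ^ 'm) set"
  assumes N: "N \<in> null_sets (borel_power \<mu>)"
    and f_eq_g: "x \<notin> N \<Longrightarrow> f x = g x"
begin

lemma N_borel [measurable]: "N \<in> sets borel"
  using N by (auto simp: null_sets_def sets_borel_power)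

sublocale P: pair_sigma_finite "borel_power \<mu> :: ('k ^ 'm) measure" \<mu>
  by intro_locales

lemma sets_pair: "sets (borel_power \<mu> \<Otimes>\<^sub>M \<mu>) = sets (borel \<Otimes>\<^sub>M borel)"
  by (intro sets_pair_measure_cong sets_borel_power sets_mu)

lemma space_pair: "space ((borel_power \<mu> :: ('k ^ 'm) measure) \<Otimes>\<^sub>M \<mu>) = UNIV"
  by (simp add: space_pair_measure space_mu)

text \<open>Away from this null set \<open>ap_Phi\<close> is the ordinary difference quotient and
  exists in every direction, which settles its domain and reduces the identity for it to
  algebra.\<close>

lemma AE_pair_nonzero: "AE z in (borel_power \<mu> :: ('k ^ 'm) measure) \<Otimes>\<^sub>M \<mu>. snd z \<noteq> 0"
proof -
  have "AE z in (borel_power \<mu> :: ('k ^ 'm) measure) \<Otimes>\<^sub>M \<mu>. snd z \<notin> {0}"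
  proof (rule P.AE_pair_measure)
    show "{z\<in>space ((borel_power \<mu> :: ('k ^ 'm) measure) \<Otimes>\<^sub>M \<mu>). snd z \<notin> {0}} \<in> sets (borel_power \<mu> \<Otimes>\<^sub>M \<mu>)"
    proof -
      have "{z\<in>space (borel \<Otimes>\<^sub>M borel :: (('k ^ 'm) \<times> 'k) measure). snd z \<notin> {0}} \<in> sets (borel \<Otimes>\<^sub>M borel)"
        by measurable
      then show ?thesis
        by (simp add: sets_pair space_pair_measure space_mu)
    qed
    show "AE x in borel_power \<mu>. AE y in \<mu>. snd (x::'k ^ 'm, y) \<notin> {0}"
      using AE_not_in[OF K.singleton_null] by simp
  qed
  then show ?thesis by simp
qed

text \<open>For fixed \<open>s\<close> the section is a translate of \<open>N\<close> and hence
  null. Fubini in the other order then shows that almost every point has null traces of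
  \<open>N\<close> on its coordinate lines.\<close>

lemma AE_pair_line: "AE z in borel_power \<mu> \<Otimes>\<^sub>M \<mu>. fst z + snd z *s axis i 1 \<notin> N"
proof -
  have Q: "{z\<in>space (borel \<Otimes>\<^sub>M borel). fst z + snd z *s axis i 1 \<in> N} \<in> sets (borel \<Otimes>\<^sub>M borel)"
    by measurable
  define Q' where "Q' = {z. fst z + snd z *s axis i 1 \<in> N}"
  have Q': "Q' \<in> sets (borel_power \<mu> \<Otimes>\<^sub>M \<mu>)"
    using Q by (simp add: sets_pair space_pair_measure Q'_def)
  have "emeasure (borel_power \<mu> \<Otimes>\<^sub>M \<mu>) Q' = (\<integral>\<^sup>+s. emeasure (borel_power \<mu>) ((\<lambda>x. x + s *s axis i 1) -` N) \<partial>\<mu>)"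
    unfolding P.emeasure_pair_measure_alt2[OF Q'] by (simp add: Q'_def vimage_def)
  also have "\<dots> = 0"
    using N by (simp add: V.translate_right null_sets_def)
  finally have "Q' \<in> null_sets (borel_power \<mu> \<Otimes>\<^sub>M \<mu>)"
    using Q' by auto
  from AE_not_in[OF this] show ?thesis
    by (simp add: Q'_def)
qed

definition good :: "'k ^ 'm \<Rightarrow> bool" where
  "good x \<longleftrightarrow> x \<notin> N \<and> (\<forall>i. AE s in \<mu>. x + s *s axis i 1 \<notin> N)"

lemma AE_good: "AE x in borel_power \<mu>. good x"
proof -
  have "AE x in borel_power \<mu>. AE s in \<mu>. x + s *s axis i 1 \<notin> N" for i
    using P.AE_pair[OF AE_pair_line[of i]] by simp
  then show ?thesis
    using AE_not_in[OF N] unfolding good_def by (simp add: AE_all_countable)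
qed

lemma null_line: "good x \<Longrightarrow> {s. x + s *s axis i 1 \<in> N} \<in> null_sets \<mu>"
proof -
  assume x: "good x"
  have "{s\<in>space borel. x + s *s axis i 1 \<in> N} \<in> sets borel"
    by measurable
  then have "{s. x + s *s axis i 1 \<in> N} \<in> sets \<mu>"
    by (simp add: sets_mu)
  then show ?thesis
    using x AE_iff_null_sets[of "{s. x + s *s axis i 1 \<in> N}" \<mu>] by (simp add: good_def)
qed

lemma null_density_bad_eq:
  assumes x: "good x"
  shows "K.null_density (F.bad i d k x) \<longleftrightarrow> K.null_density (bad i d k x)"
proof -
  let ?Z = "{s. x + s *s axis i 1 \<in> N}"
  have Z: "K.null_density ?Z"
    by (intro K.null_density_null_set null_line x)
  have "f x = g x"
    using x f_eq_g by (simp add: good_def)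
  then have "F.bad i d k x \<subseteq> bad i d k x \<union> ?Z" "bad i d k x \<subseteq> F.bad i d k x \<union> ?Z"
    using f_eq_g by (auto simp: bad_def F.bad_def)
  then show ?thesis
    using Z K.null_density_Un K.null_density_mono by meson
qed

lemma has_ap_partial_eq: "good x \<Longrightarrow> has_ap_partial \<mu> i f x = has_ap_partial \<mu> i g x"
  by (simp add: fun_eq_iff has_ap_partial_iff F.has_ap_partial_iff null_density_bad_eq)

lemma ap_partial_cong: "good x \<Longrightarrow> ap_partial \<mu> i f x = ap_partial \<mu> i g x"
  by (simp add: ap_partial_def has_ap_partial_eq)

lemma dom_ap_partial_cong: "good x \<Longrightarrow> x \<in> dom_ap_partial \<mu> i f \<longleftrightarrow> x \<in> dom_ap_partial \<mu> i g"
  by (simp add: dom_ap_partial_def has_ap_partial_eq)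

text \<open>Here the density is taken in the full space, where the translate of \<open>N\<close> is
  null; together with \<open>f x = g x\<close> this absorbs the change of function.\<close>

lemma has_ap_derivative_cong:
  assumes x: "good x" and T: "has_ap_derivative \<mu> g x T"
  shows "has_ap_derivative \<mu> f x T"
  unfolding F.has_ap_derivative_iff
proof (intro conjI allI)
  show "Vector_Spaces.linear (*s) (*s) T"
    using T by (simp add: has_ap_derivative_def)
  fix k
  let ?Z = "(\<lambda>v. x + v) -` N"
  have "?Z \<in> sets (borel_power \<mu>)"
    using measurable_sets[of "\<lambda>v. x + v" borel borel N]
    by (auto simp: sets_borel_power intro!: borel_measurable_continuous_onI continuous_intros)
  then have "?Z \<in> null_sets (borel_power \<mu>)"
    using N by (auto simp: null_sets_def V.translate)
  then have "V.null_density ({v. \<rho> ^ k * max_norm v < max_norm (g (x + v) - g x - T v)} \<union> ?Z)"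
    using T by (intro V.null_density_Un[OF _ V.null_density_null_set]) (auto simp: has_ap_derivative_iff)
  then show "V.null_density {v. \<rho> ^ k * max_norm v < max_norm (f (x + v) - f x - T v)}"
    using f_eq_g x by (elim V.null_density_mono) (auto simp: good_def)
qed

lemma dom_ap_partial_sets: "dom_ap_partial \<mu> i f \<in> sets (haar_power \<mu>)"
  unfolding haar_power_def
proof (rule sets_completion_AE_eq)
  show "dom_ap_partial \<mu> i g \<in> sets (borel_power \<mu>)"
    by (simp add: sets_borel_power dom_ap_partial_borel)
  show "AE x in borel_power \<mu>. x \<in> dom_ap_partial \<mu> i f \<longleftrightarrow> x \<in> dom_ap_partial \<mu> i g"
    using AE_good by eventually_elim (rule dom_ap_partial_cong)
qed simp

lemma ap_partial_measurable:
  "ap_partial \<mu> i f \<in> restrict_space (haar_power \<mu>) (dom_ap_partial \<mu> i f) \<rightarrow>\<^sub>M borel"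
  unfolding haar_power_def
proof (rule measurable_restrict_completionI)
  show "dom_ap_partial \<mu> i f \<in> sets (completion (borel_power \<mu>))"
    using dom_ap_partial_sets by (simp add: haar_power_def)
  fix W :: "('k ^ 'n) set" assume W: "open W"
  show "{x \<in> dom_ap_partial \<mu> i g. ap_partial \<mu> i g x \<in> W} \<in> sets (borel_power \<mu>)"
    using ap_partial_vimage_borel[OF W] by (simp add: sets_borel_power)
  show "AE x in borel_power \<mu>. x \<in> dom_ap_partial \<mu> i f \<and> ap_partial \<mu> i f x \<in> W \<longleftrightarrow>
      x \<in> {x \<in> dom_ap_partial \<mu> i g. ap_partial \<mu> i g x \<in> W}"
    using AE_good by eventually_elim (simp add: dom_ap_partial_cong ap_partial_cong)
qed

lemma dom_ap_Phi_nonzero: "snd z \<noteq> 0 \<Longrightarrow> z \<in> dom_ap_Phi \<mu> i f"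
  by (auto simp: dom_ap_Phi_def ap_Phi_exists_nonzero split: prod.split)

lemma dom_ap_Phi_sets: "dom_ap_Phi \<mu> i f \<in> sets (haar_power_Suc \<mu>)"
  unfolding haar_power_Suc_def
proof (rule sets_completion_AE_eq[OF sets.top])
  show "AE z in borel_power \<mu> \<Otimes>\<^sub>M \<mu>. z \<in> dom_ap_Phi \<mu> i f \<longleftrightarrow> z \<in> space (borel_power \<mu> \<Otimes>\<^sub>M \<mu>)"
    using AE_pair_nonzero by eventually_elim (simp add: dom_ap_Phi_nonzero space_pair)
qed (simp add: space_pair)

lemma emeasure_compl_dom_ap_Phi: "emeasure (haar_power_Suc \<mu>) (UNIV - dom_ap_Phi \<mu> i f) = 0"
proof -
  have "AE z in haar_power_Suc \<mu>. z \<notin> UNIV - dom_ap_Phi \<mu> i f"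
    unfolding haar_power_Suc_def using AE_pair_nonzero
    by (intro AE_completion) (auto elim!: eventually_mono simp: dom_ap_Phi_nonzero)
  moreover have "UNIV - dom_ap_Phi \<mu> i f \<in> sets (haar_power_Suc \<mu>)"
    using sets.compl_sets[OF dom_ap_Phi_sets[of i]] by (simp add: haar_power_Suc_def space_pair)
  ultimately show ?thesis
    using AE_iff_null_sets by blast
qed

lemma ap_Phi_measurable:
  "(\<lambda>(x, t). ap_Phi \<mu> f x (axis i 1) t)
    \<in> restrict_space (haar_power_Suc \<mu>) (dom_ap_Phi \<mu> i f) \<rightarrow>\<^sub>M borel"
  unfolding haar_power_Suc_def
proof (rule measurable_restrict_completionI)
  show "dom_ap_Phi \<mu> i f \<in> sets (completion (borel_power \<mu> \<Otimes>\<^sub>M \<mu>))"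
    using dom_ap_Phi_sets by (simp add: haar_power_Suc_def)
  fix W :: "('k ^ 'n) set" assume W: "open W"
  define S where "S = {z. snd z \<noteq> 0 \<and> diff_quot g (fst z) (axis i 1) (snd z) \<in> W}"
  show "S \<in> sets (borel_power \<mu> \<Otimes>\<^sub>M \<mu>)"
    unfolding S_def sets_pair by (rule diff_quot_vimage_borel[OF W])
  \<comment> \<open>Outside three null sets t \<noteq> 0 and neither point entering the quotient
    lies in \<open>N\<close>, so the quotients of \<open>f\<close> and \<open>g\<close>
    coincide.\<close>
  have "AE x in borel_power \<mu>. AE s in \<mu>. x \<notin> N"
    using AE_not_in[OF N] by eventually_elim simp
  then have "AE z in borel_power \<mu> \<Otimes>\<^sub>M \<mu>. fst z \<notin> N"
  proof (intro P.AE_pair_measure)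
    have "{z\<in>space (borel \<Otimes>\<^sub>M borel :: (('k ^ 'm) \<times> 'k) measure). fst z \<notin> N} \<in> sets (borel \<Otimes>\<^sub>M borel)"
      by measurable
    then show "{z\<in>space (borel_power \<mu> \<Otimes>\<^sub>M \<mu>). fst z \<notin> N} \<in> sets (borel_power \<mu> \<Otimes>\<^sub>M \<mu>)"
      by (simp add: sets_pair space_pair_measure space_mu)
  qed simp
  then show "AE z in borel_power \<mu> \<Otimes>\<^sub>M \<mu>. z \<in> dom_ap_Phi \<mu> i f \<and>
      (case z of (x, t) \<Rightarrow> ap_Phi \<mu> f x (axis i 1) t) \<in> W \<longleftrightarrow> z \<in> S"
    using AE_pair_nonzero AE_pair_line[of i]
  proof eventually_elim
    case (elim z)
    have "(case z of (x, t) \<Rightarrow> ap_Phi \<mu> f x (axis i 1) t) = diff_quot f (fst z) (axis i 1) (snd z)"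
      using elim(2) by (simp add: case_prod_beta ap_Phi_nonzero)
    also have "\<dots> = diff_quot g (fst z) (axis i 1) (snd z)"
      using elim(1,3) by (simp add: diff_quot_def f_eq_g)
    finally show ?case
      using elim(2) by (simp add: S_def dom_ap_Phi_nonzero)
  qed
qed

lemma AE_ap_derivative:
  "AE x in haar_power \<mu>. x \<in> (\<Inter>i. dom_ap_partial \<mu> i f) \<longrightarrow>
     ap_differentiable \<mu> f x
     \<and> (\<forall>v. ap_derivative \<mu> f x v = (\<Sum>i\<in>UNIV. v $ i *s ap_partial \<mu> i f x))"
  unfolding haar_power_def
proof (rule AE_completion)
  show "AE x in borel_power \<mu>. x \<in> (\<Inter>i. dom_ap_partial \<mu> i f) \<longrightarrow>
     ap_differentiable \<mu> f x
     \<and> (\<forall>v. ap_derivative \<mu> f x v = (\<Sum>i\<in>UNIV. v $ i *s ap_partial \<mu> i f x))"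
    using AE_good AE_generic
  proof eventually_elim
    case (elim x)
    show ?case
    proof
      assume "x \<in> (\<Inter>i. dom_ap_partial \<mu> i f)"
      then have "has_ap_derivative \<mu> g x (L x)"
        using elim by (intro has_ap_derivative_L) (auto simp: dom_ap_partial_cong)
      then have D: "has_ap_derivative \<mu> f x (L x)"
        by (rule has_ap_derivative_cong[OF elim(1)])
      then have "ap_derivative \<mu> f x = L x"
        unfolding ap_derivative_def by (rule the_equality[where P = "has_ap_derivative \<mu> f x"]) (rule F.has_ap_derivative_unique[OF _ D])
      then show "ap_differentiable \<mu> f x
          \<and> (\<forall>v. ap_derivative \<mu> f x v = (\<Sum>i\<in>UNIV. v $ i *s ap_partial \<mu> i f x))"
        using D elim(1) by (auto simp: ap_differentiable_def L_def ap_partial_cong)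
    qed
  qed
qed

end

theorem mainTheorem3:
  fixes \<mu> :: "'k::nonarch_local_field measure"
    and f :: "'k ^ 'm::{finite,linorder} \<Rightarrow> 'k ^ 'n"
  assumes haar: "haar_measure \<mu>"
    and unit_ball: "emeasure \<mu> (cball 0 1) = 1"
    and modulus: "absv_is_modulus \<mu>"
    and f_measurable: "f \<in> haar_power \<mu> \<rightarrow>\<^sub>M borel"
  shows "(\<forall>i. dom_ap_partial \<mu> i f \<in> sets (haar_power \<mu>)
            \<and> dom_ap_Phi \<mu> i f \<in> sets (haar_power_Suc \<mu>)
            \<and> emeasure (haar_power_Suc \<mu>) (UNIV - dom_ap_Phi \<mu> i f) = 0
            \<and> ap_partial \<mu> i f
                \<in> restrict_space (haar_power \<mu>) (dom_ap_partial \<mu> i f) \<rightarrow>\<^sub>M borel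
            \<and> (\<lambda>(x, t). ap_Phi \<mu> f x (axis i 1) t)
                \<in> restrict_space (haar_power_Suc \<mu>) (dom_ap_Phi \<mu> i f) \<rightarrow>\<^sub>M borel)
      \<and> (AE (x, t) in haar_power_Suc \<mu>. (x, t) \<in> (\<Inter>i. dom_ap_Phi \<mu> i f) \<longrightarrow>
          (\<forall>v. ap_Phi_exists \<mu> f x v t
             \<and> (\<forall>i. v $ i \<noteq> 0 \<longrightarrow>
                  ap_Phi_exists \<mu> f (x + t *s (\<Sum>j\<in>{i<..}. v $ j *s axis j 1)) (axis i 1) (v $ i * t))
             \<and> ap_Phi \<mu> f x v t =
                 (\<Sum>i\<in>UNIV. if v $ i = 0 then 0 else v $ i *s
                    ap_Phi \<mu> f (x + t *s (\<Sum>j\<in>{i<..}. v $ j *s axis j 1)) (axis i 1) (v $ i * t))))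
      \<and> (AE x in haar_power \<mu>. x \<in> (\<Inter>i. dom_ap_partial \<mu> i f) \<longrightarrow>
          ap_differentiable \<mu> f x
          \<and> (\<forall>v. ap_derivative \<mu> f x v = (\<Sum>i\<in>UNIV. v $ i *s ap_partial \<mu> i f x)))"
proof -
  obtain p :: 'k where p: "p \<noteq> 0" "absv p < 1"
    using exists_absv_less_1 by blast
  interpret haar_field \<mu> p
    using haar unit_ball modulus p by unfold_locales
  obtain g N where g: "g \<in> borel_power \<mu> \<rightarrow>\<^sub>M borel" "N \<in> null_sets (borel_power \<mu>)"
    "\<And>x. x \<in> space (borel_power \<mu>) - N \<Longrightarrow> f x = g x"
    using completion_AE_eq_borel_measurable[OF f_measurable[unfolded haar_power_def]] by blast
  interpret haar_field_modification \<mu> p f g N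
  proof
    show "g \<in> borel \<rightarrow>\<^sub>M borel"
      using g(1) measurable_cong_sets[OF sets_borel_power refl] by blast
    show "f x = g x" if "x \<notin> N" for x
      using g(3) that by (simp add: borel_power_def)
  qed (rule g(2))
  have "AE (x, t) in haar_power_Suc \<mu>. (x, t) \<in> (\<Inter>i. dom_ap_Phi \<mu> i f) \<longrightarrow>
          (\<forall>v. ap_Phi_exists \<mu> f x v t
             \<and> (\<forall>i. v $ i \<noteq> 0 \<longrightarrow>
                  ap_Phi_exists \<mu> f (x + t *s (\<Sum>j\<in>{i<..}. v $ j *s axis j 1)) (axis i 1) (v $ i * t))
             \<and> ap_Phi \<mu> f x v t =
                 (\<Sum>i\<in>UNIV. if v $ i = 0 then 0 else v $ i *s
                    ap_Phi \<mu> f (x + t *s (\<Sum>j\<in>{i<..}. v $ j *s axis j 1)) (axis i 1) (v $ i * t)))"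
    unfolding haar_power_Suc_def
  \<comment> \<open>The exceptional set is \<open>t = 0\<close> and does not depend on
    \<open>v\<close>. Once t \<noteq> 0, a summand with v $ i \<noteq> 0 has nonzero argument
    \<open>v $ i * t\<close>, so all values of \<open>ap_Phi\<close> that occur are ordinary
    quotients.\<close>
  proof (rule AE_completion, use AE_pair_nonzero in eventually_elim)
    case (elim z)
    obtain x t where z: "z = (x, t)"
      by (cases z)
    then have t: "t \<noteq> 0"
      using elim by simp
    have *: "ap_Phi_exists \<mu> f x v t"
      "v $ i \<noteq> 0 \<longrightarrow>
        ap_Phi_exists \<mu> f (x + t *s (\<Sum>j\<in>{i<..}. v $ j *s axis j 1)) (axis i 1) (v $ i * t)" for v i
      using t by (simp_all add: ap_Phi_exists_nonzero)
    have "ap_Phi \<mu> f x v t =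
       (\<Sum>i\<in>UNIV. if v $ i = 0 then 0 else v $ i *s
          ap_Phi \<mu> f (x + t *s (\<Sum>j\<in>{i<..}. v $ j *s axis j 1)) (axis i 1) (v $ i * t))" for v
      unfolding ap_Phi_nonzero[OF t] diff_quot_telescope[OF t]
      using t by (intro sum.cong) (auto simp: ap_Phi_nonzero)
    with * show ?case
      by (simp add: z)
  qed
  then show ?thesis
    using dom_ap_partial_sets dom_ap_Phi_sets emeasure_compl_dom_ap_Phi ap_partial_measurable
      ap_Phi_measurable AE_ap_derivative by blast
qed

end
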